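(* If $n\ge 2$ is an integer, then $$c(n,3)\le \min\{20369,3^{\omega(n)}\}(n-1)+1,$$ where $\omega(n)$ denotes the number of distinct prime factors of $n$.
   Context: Let $F$ be a set of prime numbers with $|F|=r$. A positive integer is called smooth over $F$ if each of its prime factors belongs to $F$. $c(n,r)$ denotes the least positive integer $t$ such that any sequence $S$ (repetitions allowed) of length $t$ of integers smooth over $F$ has a non-empty subsequence $S'$ such that the product of all the terms of $S'$ is an $n$th power of an integer. (This number depends on $F$ only through $r=|F|$.) *)

theory Defs
  imports "HOL-Computational_Algebra.Nth_Powers" "HOL-Computational_Algebra.Primes"
    "HOL-Library.Sublist" "HOL-Library.FuncSet"
begin

definition smooth_over :: "nat set \<Rightarrow> nat \<Rightarrow> bool" where
  "smooth_over F a \<longleftrightarrow> a > 0 \<and> prime_factors a \<subseteq> F"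

definition forces_nth_power :: "nat \<Rightarrow> nat set \<Rightarrow> nat \<Rightarrow> bool" where
  "forces_nth_power n F t \<longleftrightarrow>
     (\<forall>S. length S = t \<and> (\<forall>a\<in>set S. smooth_over F a) \<longrightarrow>
        (\<exists>S'. subseq S' S \<and> S' \<noteq> [] \<and> is_nth_power n (int (prod_list S'))))"

text \<open>
  The number \<open>c(n,r)\<close>, computed from a particular set \<open>F\<close> of \<open>r\<close> primes. Its value depends on
  \<open>F\<close> only through \<open>r\<close>, so \<open>c(n,r)\<close> is \<open>power_const n F\<close> for any such \<open>F\<close>.
  For finite \<open>F\<close> and positive \<open>n\<close> the minimum is attained, see \<open>forces_nth_power_exists\<close>.
\<close>

definition power_const :: "nat \<Rightarrow> nat set \<Rightarrow> nat" where
  "power_const n F = (LEAST t. t > 0 \<and> forces_nth_power n F t)"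

lemma forces_nth_power_exists:
  assumes F: "finite F" "\<forall>p\<in>F. prime p" and n: "n > 0"
  shows "\<exists>t>0. forces_nth_power n F t"
proof (intro exI[of _ "n ^ card F"] conjI)
  show "n ^ card F > 0" using n by simp
  show "forces_nth_power n F (n ^ card F)"
    unfolding forces_nth_power_def
  proof (intro allI impI, elim conjE)
    fix S :: "nat list"
    assume len: "length S = n ^ card F" and sm: "\<forall>a\<in>set S. smooth_over F a"
    define f where "f = (\<lambda>i. \<lambda>p\<in>F. multiplicity p (prod_list (take i S)) mod n)"
    have "f ` {..length S} \<subseteq> F \<rightarrow>\<^sub>E {..<n}"
      using n by (auto simp: f_def)
    then have "card (f ` {..length S}) \<le> n ^ card F"
      using card_mono[of "F \<rightarrow>\<^sub>E {..<n}"] F(1) by (simp add: finite_PiE card_PiE)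
    then have "\<not> inj_on f {..length S}"
      using len by (intro pigeonhole) simp
    then obtain i j where ij: "i < j" "j \<le> length S" "f i = f j"
      unfolding inj_on_def by (metis atMost_iff linorder_neqE_nat)
    define T where "T = drop i (take j S)"
    have T: "T \<noteq> []" "subseq T S"
      using ij unfolding T_def
      by (auto intro: subseq_order.trans[of _ "take j S"] prefix_imp_subseq suffix_imp_subseq
            take_is_prefix suffix_drop)
    have pos: "prod_list xs > 0" if "set xs \<subseteq> set S" for xs
      using that sm by (induction xs) (auto simp: smooth_over_def)
    have pf: "prime_factors (prod_list xs) \<subseteq> F" if "set xs \<subseteq> set S" for xs
      using that
    proof (induction xs)
      case (Cons a xs)
      have "prime_factors (a * prod_list xs) = prime_factors a \<union> prime_factors (prod_list xs)"
        using Cons.prems pos[of xs] sm by (intro prime_factors_product) (auto simp: smooth_over_def)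
      then show ?case using Cons sm by (auto simp: smooth_over_def)
    qed simp
    have Tset: "set T \<subseteq> set S"
      unfolding T_def by (meson order_trans set_drop_subset set_take_subset)
    have split: "prod_list (take j S) = prod_list (take i S) * prod_list T"
    proof -
      have "take j S = take i S @ T"
        using ij by (simp add: T_def) (metis append_take_drop_id min.absorb1 less_imp_le take_take)
      then show ?thesis by simp
    qed
    have "n dvd multiplicity p (prod_list T)" if p: "prime p" for p
    proof (cases "p \<in> F")
      case True
      have "multiplicity p (prod_list (take j S))
            = multiplicity p (prod_list (take i S)) + multiplicity p (prod_list T)"
        unfolding split using pos[OF Tset] pos[of "take i S"] p
        by (intro prime_elem_multiplicity_mult_distrib) (auto dest: in_set_takeD)
      moreover have "multiplicity p (prod_list (take i S)) mod n
            = multiplicity p (prod_list (take j S)) mod n"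
        using fun_cong[OF ij(3), of p] True by (simp add: f_def)
      ultimately show ?thesis
        by (metis add_diff_cancel_left' le_add1 mod_eq_dvd_iff_nat)
    next
      case False
      then have "\<not> p dvd prod_list T"
        using pf[OF Tset] pos[OF Tset] p by (auto simp: prime_factors_dvd)
      then show ?thesis by (simp add: not_dvd_imp_multiplicity_0)
    qed
    then have "is_nth_power n (prod_list T)"
      using n by (simp add: is_nth_power_conv_multiplicity_nat)
    then have "is_nth_power n (int (prod_list T))"
      by (metis is_nth_power_def of_nat_power)
    then show "\<exists>S'. subseq S' S \<and> S' \<noteq> [] \<and> is_nth_power n (int (prod_list S'))"
      using T by blast
  qed
qed

end

theory Submission
  imports Defs Complex_Main "HOL-Library.Product_Plus" "HOL-Library.Disjoint_Sets" "HOL-Analysis.L2_Norm"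
begin

text \<open>
  Taking exponents of the three primes turns the terms of the sequence into vectors in
  \<open>\<nat>\<^sup>3\<close>, and a subsequence has an \<open>n\<close>th power as its product iff its exponent vectors sum to zero
  modulo \<open>n\<close>. So the theorem bounds the Davenport constant of \<open>C\<^sub>n\<^sup>3\<close>, where \<open>C\<^sub>n\<close> is the cyclic group
  of order \<open>n\<close>. Both bounds come from moduli that are easier to treat, by extracting many disjoint
  zero sums modulo one factor and then a zero sum among them modulo the other factor
  (\<open>short_zero_sums_mult\<close>).

  The bound with \<open>3 ^ \<omega>(n)\<close> rests on Olson's theorem for prime powers \<open>q\<close>: any \<open>3(q - 1) + 1\<close>
  vectors have a nonempty zero sum modulo \<open>q\<close> (\<open>short_zero_sums_prime_power\<close>). The indicator of
  the zero vector is, modulo \<open>p\<close>, a polynomial of degree \<open>3(q - 1)\<close> in the sense of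
  finite differences, so its alternating sum over the subsets of a larger family vanishes; if the
  empty set were the only zero sum, that alternating sum would be 1. Every further prime power
  costs a factor 3, because zero sums modulo \<open>q\<close> may be about three times as long as \<open>q\<close>.

  The bound with 20369 does not lose anything at each step, because it uses zero sums of length at
  most \<open>p\<close> modulo every prime \<open>p\<close>: any \<open>20369(p - 1) + 1\<close> vectors contain one
  (\<open>short_zero_sums_prime\<close>). The argument follows Alon and Dubiner. For odd \<open>p\<close>, if some affine plane modulo
  \<open>p\<close> contains \<open>4p - 2\<close> of the vectors, a polynomial argument of the same kind as
  above, due to Ronyai, yields a zero sum of length exactly \<open>p\<close> inside the plane
  (\<open>zero_sum_in_affine_plane\<close>). For \<open>p < 5000\<close> one of \<open>p\<close> parallel planes is that rich by
  the pigeonhole principle.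

  For larger \<open>p\<close> with no rich plane, two disjoint families \<open>D\<^sub>1\<close>, \<open>D\<^sub>2\<close> of at most
  \<open>(p - 1)/2\<close> vectors are built greedily such that the subset sums of each fill more than half of
  all residue vectors (\<open>subset_sums_exceed_half\<close>). Then every residue vector, in particular the
  negative of a further vector, is a sum of a subset sum of \<open>D\<^sub>1\<close> and one of \<open>D\<^sub>2\<close>, which gives a
  zero sum of length at most \<open>p\<close>. Adding a vector \<open>b\<close> to a family with set of subset sums \<open>Y\<close>
  enlarges \<open>Y\<close> by the number of elements of \<open>Y\<close> that leave \<open>Y\<close> under translation by \<open>b\<close>, and two
  mechanisms make this number large for some available \<open>b\<close>. While \<open>Y\<close> is small, the
  Loomis-Whitney inequality provides a growth of order \<open>|Y|\<^sup>2\<^sup>/\<^sup>3\<close> for one of any three independent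
  translations, so \<open>|Y|\<close> grows like the cube of the number of steps and reaches \<open>(p/35)\<^sup>3\<close> after
  \<open>p/5\<close> steps. From there Fourier analysis takes over: since few vectors lie close to any plane, some
  \<open>b\<close> enlarges \<open>Y\<close> by the factor \<open>1 + 100/p\<close>, and the remaining constant factor is gained in fewer
  than \<open>3p/10\<close> further steps.
\<close>

section \<open>Zero sums of bounded length\<close>

type_synonym nat3 = "nat \<times> nat \<times> nat"

definition zero_mod :: "nat \<Rightarrow> nat3 \<Rightarrow> bool" where
  "zero_mod n v \<longleftrightarrow> n dvd fst v \<and> n dvd fst (snd v) \<and> n dvd snd (snd v)"

text \<open>
  Families are indexed by finite sets of natural numbers, so that repeated vectors are allowed and
  sub-families are subsets. The bound \<open>l\<close> on the length is what makes the notion iterate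
  efficiently: with \<open>l = t\<close> it is the statement that the Davenport constant of \<open>C\<^sub>n\<^sup>3\<close> is at most \<open>t\<close>,
  and with \<open>l = n\<close> it is the corresponding statement for zero sums of length at most \<open>n\<close>.
\<close>

definition short_zero_sums :: "nat \<Rightarrow> nat \<Rightarrow> nat \<Rightarrow> bool" where
  "short_zero_sums n l t \<longleftrightarrow> (\<forall>(a :: nat \<Rightarrow> nat3) I. finite I \<longrightarrow> card I \<ge> t \<longrightarrow>
     (\<exists>X\<subseteq>I. X \<noteq> {} \<and> card X \<le> l \<and> zero_mod n (sum a X)))"

lemma zero_mod_sum_mult:
  assumes "zero_mod n (sum b K)" "\<And>j. j \<in> K \<Longrightarrow> v j = (m * fst (b j), m * fst (snd (b j)), m * snd (snd (b j)))"
  shows "zero_mod (m * n) (sum v K)"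
proof -
  have "sum v K = (m * fst (sum b K), m * fst (snd (sum b K)), m * snd (snd (sum b K)))"
    using assms(2)
    by (simp add: prod_eq_iff fst_sum snd_sum sum_distrib_left cong: sum.cong)
  then show ?thesis using assms(1) by (auto simp: zero_mod_def)
qed

text \<open>
  Each extracted zero sum removes at most \<open>l\<close> indices, so the extraction can be repeated as long as
  \<open>s\<close> indices are left.
\<close>

lemma disjoint_short_zero_sums:
  fixes I :: "nat set"
  assumes P: "short_zero_sums m l s" and fin: "finite I" and card: "card I + l \<ge> l * t + s"
  shows "\<exists>X. (\<forall>j<t. X j \<subseteq> I \<and> X j \<noteq> {} \<and> card (X j) \<le> l \<and> zero_mod m (sum a (X j)))
           \<and> disjoint_family_on X {..<t}"
  using card
proof (induction t)
  case 0
  then show ?case by (auto simp: disjoint_family_on_def)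
next
  case (Suc t)
  then obtain X where X: "\<forall>j<t. X j \<subseteq> I \<and> X j \<noteq> {} \<and> card (X j) \<le> l \<and> zero_mod m (sum a (X j))"
     "disjoint_family_on X {..<t}" by fastforce
  let ?U = "\<Union>j<t. X j"
  have "card ?U \<le> (\<Sum>j<t. card (X j))" by (rule card_UN_le) simp
  also have "\<dots> \<le> (\<Sum>j<t. l)" using X by (intro sum_mono) auto
  finally have "card ?U \<le> l * t" by (simp add: mult.commute)
  moreover have "card (I - ?U) \<ge> card I - card ?U"
    by (rule diff_card_le_card_Diff) (use X fin in \<open>auto intro: finite_subset\<close>)
  ultimately have "card (I - ?U) \<ge> s" using Suc.prems by simp
  then obtain Z where Z: "Z \<subseteq> I - ?U" "Z \<noteq> {}" "card Z \<le> l" "zero_mod m (sum a Z)"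
    using P[unfolded short_zero_sums_def, rule_format, of "I - ?U" a] fin by auto
  show ?case
  proof (intro exI[of _ "X(t := Z)"] conjI)
    show "\<forall>j<Suc t. (X(t := Z)) j \<subseteq> I \<and> (X(t := Z)) j \<noteq> {} \<and> card ((X(t := Z)) j) \<le> l
        \<and> zero_mod m (sum a ((X(t := Z)) j))"
      using X Z by (auto simp: less_Suc_eq)
    show "disjoint_family_on (X(t := Z)) {..<Suc t}"
      using X(2) Z(1) by (fastforce simp: disjoint_family_on_def less_Suc_eq)
  qed
qed

text \<open>
  The sums of \<open>t\<close> disjoint zero sums modulo \<open>m\<close> are divisible by \<open>m\<close>; a zero sum modulo \<open>n\<close> of
  the quotients is a zero sum modulo \<open>m * n\<close> of the original vectors.
\<close>

lemma short_zero_sums_mult: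
  assumes m: "short_zero_sums m l s" and n: "short_zero_sums n l' t" and t: "t \<ge> 1"
  shows "short_zero_sums (m * n) (l * l') (l * (t - 1) + s)"
  unfolding short_zero_sums_def
proof (intro allI impI)
  fix a :: "nat \<Rightarrow> nat3" and I :: "nat set"
  assume I: "finite I" "card I \<ge> l * (t - 1) + s"
  have "card I + l \<ge> l * t + s"
    using I t by (cases t) auto
  then obtain X where X: "\<And>j. j < t \<Longrightarrow> X j \<subseteq> I" "\<And>j. j < t \<Longrightarrow> X j \<noteq> {}"
      "\<And>j. j < t \<Longrightarrow> card (X j) \<le> l" "\<And>j. j < t \<Longrightarrow> zero_mod m (sum a (X j))"
      "disjoint_family_on X {..<t}"
    using disjoint_short_zero_sums[OF m I(1), of t a] by metis
  \<comment> \<open>the divisions are exact, as each extracted sum vanishes modulo \<open>m\<close>\<close>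
  define b where "b = (\<lambda>j. (fst (sum a (X j)) div m, fst (snd (sum a (X j))) div m, snd (snd (sum a (X j))) div m))"
  obtain K where K: "K \<subseteq> {..<t}" "K \<noteq> {}" "card K \<le> l'" "zero_mod n (sum b K)"
    using n unfolding short_zero_sums_def by (metis card_lessThan finite_lessThan order_refl)
  have finK: "finite K" using K by (auto intro: finite_subset)
  have finX: "finite (X j)" if "j \<in> K" for j using that X K I by (meson finite_subset lessThan_iff subsetD)
  have dis: "disjoint_family_on X K" using K(1) X(5) by (rule disjoint_family_on_mono)
  have "sum a (\<Union>j\<in>K. X j) = (\<Sum>j\<in>K. sum a (X j))"
    using finK finX dis by (intro sum.UNION_disjoint) (auto simp: disjoint_family_on_def)
  moreover have "zero_mod (m * n) (\<Sum>j\<in>K. sum a (X j))"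
    using K(1) X(4) by (intro zero_mod_sum_mult[OF K(4)]) (auto simp: b_def zero_mod_def prod_eq_iff)
  moreover have "(\<Union>j\<in>K. X j) \<subseteq> I" "(\<Union>j\<in>K. X j) \<noteq> {}" 
    using K(1,2) X(1,2) by (auto simp: subset_iff)
  moreover have "card (\<Union>j\<in>K. X j) \<le> l * l'"
  proof -
    have "card (\<Union>j\<in>K. X j) \<le> (\<Sum>j\<in>K. card (X j))" using finK by (rule card_UN_le)
    also have "\<dots> \<le> (\<Sum>j\<in>K. l)" using X(3) K by (intro sum_mono) auto
    also have "\<dots> \<le> l * l'" using K by simp
    finally show ?thesis .
  qed
  ultimately show "\<exists>X\<subseteq>I. X \<noteq> {} \<and> card X \<le> l * l' \<and> zero_mod (m * n) (sum a X)"
    by (intro exI[of _ "\<Union>j\<in>K. X j"]) simp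
qed

lemma short_zero_sums_one: "short_zero_sums 1 1 1"
  unfolding short_zero_sums_def
proof (intro allI impI)
  fix a :: "nat \<Rightarrow> nat3" and I :: "nat set"
  assume "finite I" "1 \<le> card I"
  then obtain i where "i \<in> I" by fastforce
  then show "\<exists>X\<subseteq>I. X \<noteq> {} \<and> card X \<le> 1 \<and> zero_mod 1 (sum a X)"
    by (intro exI[of _ "{i}"]) (auto simp: zero_mod_def)
qed

lemma short_zero_sums_mono:
  "short_zero_sums n l t \<Longrightarrow> l \<le> l' \<Longrightarrow> t \<le> t' \<Longrightarrow> short_zero_sums n l' t'"
  unfolding short_zero_sums_def by (metis (no_types) le_trans)

section \<open>Integer-valued polynomials and alternating sums over subsets\<close>

text \<open>
  The functions all of whose iterated differences of order \<open>d\<close> vanish, which is the notion of a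
  polynomial of degree less than \<open>d\<close> on a commutative monoid. It avoids any choice
  of coordinates and covers the binomial coefficients directly.
\<close>

primrec degree_below :: "nat \<Rightarrow> ('a::comm_monoid_add \<Rightarrow> int) \<Rightarrow> bool" where
  "degree_below 0 f \<longleftrightarrow> (\<forall>v. f v = 0)"
| "degree_below (Suc d) f \<longleftrightarrow> (\<forall>a. degree_below d (\<lambda>v. f (v + a) - f v))"

lemma degree_below_zero: "degree_below d (\<lambda>_. 0)"
  by (induction d) auto

lemma degree_below_const: "degree_below (Suc d) (\<lambda>_. c)"
  by (simp add: degree_below_zero)

lemma degree_below_Suc: "degree_below d f \<Longrightarrow> degree_below (Suc d) f"
proof (induction d arbitrary: f)
  case (Suc d)
  then have "degree_below (Suc d) (\<lambda>v. f (v + a) - f v)" for a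
    by (metis degree_below.simps(2))
  then show ?case by (subst degree_below.simps) blast
qed simp

lemma degree_below_mono: "degree_below d f \<Longrightarrow> d \<le> e \<Longrightarrow> degree_below e f"
  by (induction e) (auto simp: le_Suc_eq degree_below_Suc simp del: degree_below.simps)

lemma degree_below_add:
  "degree_below d f \<Longrightarrow> degree_below d g \<Longrightarrow> degree_below d (\<lambda>v. f v + g v)"
proof (induction d arbitrary: f g)
  case (Suc d)
  have "degree_below d (\<lambda>v. (f (v + a) - f v) + (g (v + a) - g v))" for a
    using Suc by auto
  then show ?case by (simp add: algebra_simps)
qed simp

lemma degree_below_cmult: "degree_below d f \<Longrightarrow> degree_below d (\<lambda>v. c * f v)"
proof (induction d arbitrary: f)
  case (Suc d)
  have "degree_below d (\<lambda>v. c * (f (v + a) - f v))" for a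
    using Suc by auto
  then show ?case by (simp add: algebra_simps)
qed simp

lemma degree_below_sum:
  "(\<And>i. i \<in> I \<Longrightarrow> degree_below d (f i)) \<Longrightarrow> degree_below d (\<lambda>v. \<Sum>i\<in>I. f i v)"
  by (induction I rule: infinite_finite_induct)
    (auto intro: degree_below_add simp: degree_below_zero)

lemma degree_below_shift: "degree_below d f \<Longrightarrow> degree_below d (\<lambda>v. f (v + a))"
proof (induction d arbitrary: f)
  case (Suc d)
  have "degree_below d (\<lambda>v. f (v + a + b) - f (v + a))" for b
    using Suc.IH[of "\<lambda>v. f (v + b) - f v"] Suc.prems by simp
  moreover have "v + a + b = v + b + a" for v b by (simp add: ac_simps)
  ultimately show ?case by simp
qed simp

text \<open>
  Degrees add, by the Leibniz rule for differences: the difference of \<open>f * g\<close> is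
  \<open>\<Delta>f\<close> times a translate of \<open>g\<close> plus \<open>f * \<Delta>g\<close>.
\<close>

lemma degree_below_mult:
  "degree_below (Suc d) f \<Longrightarrow> degree_below (Suc e) g \<Longrightarrow>
    degree_below (Suc (d + e)) (\<lambda>v. f v * g v)"
proof (induction "d + e" arbitrary: d e f g rule: less_induct)
  case less
  have zero: "degree_below k (\<lambda>v. f v * g v)" if "\<forall>v. f v * g v = 0" for f g :: "'a \<Rightarrow> int" and k
  proof -
    have "(\<lambda>v. f v * g v) = (\<lambda>_. 0)" using that by blast
    then show ?thesis by (simp only: degree_below_zero)
  qed
  have left: "degree_below (d + e) (\<lambda>v. (f (v + a) - f v) * g (v + a))" for a
  proof (cases d)
    case 0
    then show ?thesis using less.prems by (intro zero) auto
  next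
    case (Suc d')
    have "degree_below (Suc d') (\<lambda>v. f (v + a) - f v)"
      using less.prems(1) Suc by (subst (asm) degree_below.simps(2)) auto
    with Suc less.prems show ?thesis
      using less.hyps[of d' e "\<lambda>v. f (v + a) - f v" "\<lambda>v. g (v + a)"]
      by (simp add: degree_below_shift del: degree_below.simps)
  qed
  have right: "degree_below (d + e) (\<lambda>v. f v * (g (v + a) - g v))" for a
  proof (cases e)
    case 0
    then show ?thesis using less.prems by (intro zero) auto
  next
    case (Suc e')
    have "degree_below (Suc e') (\<lambda>v. g (v + a) - g v)"
      using less.prems(2) Suc by (subst (asm) degree_below.simps(2)) auto
    with Suc less.prems show ?thesis
      using less.hyps[of d e' "f" "\<lambda>v. g (v + a) - g v"]
      by (simp del: degree_below.simps)
  qed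
  have "f (v + a) * g (v + a) - f v * g v =
      (f (v + a) - f v) * g (v + a) + f v * (g (v + a) - g v)" for v a
    by (simp add: algebra_simps)
  then show ?case
    using degree_below_add[OF left right] by simp
qed

text \<open>
  Vandermonde's identity expresses a difference of a binomial coefficient through binomial
  coefficients with smaller lower index. The constant \<open>c\<close> is there because the indicator functions
  below use \<open>(m + q - 1) choose (q - 1)\<close>.
\<close>

lemma degree_below_binomial:
  assumes add: "\<And>v w. \<phi> (v + w) = (\<phi> v + \<phi> w :: nat)"
  shows "degree_below (Suc k) (\<lambda>v. int ((\<phi> v + c) choose k))"
proof (induction k arbitrary: c rule: less_induct)
  case (less k)
  have "degree_below k (\<lambda>v. int ((\<phi> (v + a) + c) choose k) - int ((\<phi> v + c) choose k))" for a
  proof -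
    have "int ((\<phi> (v + a) + c) choose k) - int ((\<phi> v + c) choose k) =
        (\<Sum>j<k. int (\<phi> a choose (k - j)) * int ((\<phi> v + c) choose j))" for v
    proof -
      have "(\<phi> (v + a) + c) choose k = (\<Sum>j\<le>k. ((\<phi> v + c) choose j) * (\<phi> a choose (k - j)))"
        using vandermonde[of "\<phi> v + c" "\<phi> a" k] by (simp add: add ac_simps)
      also have "\<dots> = (\<Sum>j<k. ((\<phi> v + c) choose j) * (\<phi> a choose (k - j))) + ((\<phi> v + c) choose k)"
        by (simp flip: lessThan_Suc_atMost)
      finally show ?thesis by (simp add: mult.commute)
    qed
    moreover have "degree_below k (\<lambda>v. int (\<phi> a choose (k - j)) * int ((\<phi> v + c) choose j))"
      if "j < k" for j
      using degree_below_mono[OF less.IH[OF that, of c], of k] that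
      by (intro degree_below_cmult) simp
    ultimately show ?thesis
      by (simp only:) (intro degree_below_sum, simp)
  qed
  then show ?case by simp
qed

text \<open>
  Pairing the subsets that contain a fixed index with those that do not turns the alternating sum of
  \<open>f\<close> into that of a difference of \<open>f\<close>; after \<open>d\<close> indices nothing is left.
\<close>

lemma alternating_sum_eq_0:
  assumes "degree_below d f" "finite I" "card I \<ge> d"
  shows "(\<Sum>X\<in>Pow I. (-1) ^ card X * f (\<Sum>i\<in>X. a i)) = 0"
  using assms(2,1,3)
proof (induction I arbitrary: d f rule: finite_induct)
  case (insert i I)
  have dis: "Pow I \<inter> insert i ` Pow I = {}"
    using insert.hyps by auto
  have inj: "inj_on (insert i) (Pow I)"
    using insert.hyps by (auto simp: inj_on_def insert_ident)
  have D: "degree_below (d - 1) (\<lambda>v. f (v + a i) - f v)"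
  proof (cases d)
    case 0 
    then show ?thesis using insert.prems by simp
  next
    case (Suc e)
    then show ?thesis using insert.prems by simp
  qed
  have "(\<Sum>X\<in>Pow (insert i I). (-1) ^ card X * f (sum a X)) =
      (\<Sum>X\<in>Pow I. (-1) ^ card X * f (sum a X)) +
      (\<Sum>X\<in>Pow I. (-1) ^ card (insert i X) * f (sum a (insert i X)))"
    unfolding Pow_insert using insert.hyps dis inj
    by (subst sum.union_disjoint) (auto simp: sum.reindex)
  also have "(\<Sum>X\<in>Pow I. (-1) ^ card (insert i X) * f (sum a (insert i X)))
      = (\<Sum>X\<in>Pow I. - ((-1) ^ card X * f (sum a X + a i)))"
  proof (intro sum.cong refl)
    fix X assume "X \<in> Pow I"
    then have "finite X" "i \<notin> X" using insert.hyps by (auto intro: finite_subset)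
    then show "(-1) ^ card (insert i X) * f (sum a (insert i X)) = - ((-1) ^ card X * f (sum a X + a i))"
      by (simp add: add.commute)
  qed
  also have "(\<Sum>X\<in>Pow I. (-1) ^ card X * f (sum a X)) + \<dots> =
      - (\<Sum>X\<in>Pow I. (-1) ^ card X * (f (sum a X + a i) - f (sum a X)))"
    by (simp add: sum_subtractf algebra_simps sum_negf)
  also have "\<dots> = 0"
    using insert.IH[OF D] insert.prems insert.hyps by simp
  finally show ?case .
qed simp

section \<open>Zero sums modulo prime powers\<close>

text \<open>
  With \<open>q = p ^ k\<close>, the product of \<open>m + q\<close> and this binomial coefficient is a multiple of \<open>q\<close>. If
  \<open>p\<close> did not divide the coefficient, \<open>q\<close> would divide \<open>m + q\<close> and hence \<open>m\<close>.
\<close>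

lemma prime_dvd_binomial_unless_dvd:
  fixes p k m :: nat
  assumes p: "prime p" and m: "\<not> p ^ k dvd m"
  shows "p dvd (m + (p ^ k - 1)) choose (p ^ k - 1)"
proof (rule ccontr)
  assume n: "\<not> p dvd (m + (p ^ k - 1)) choose (p ^ k - 1)"
  have q: "p ^ k > 0" using p prime_gt_0_nat by simp
  have "Suc (p ^ k - 1) * (Suc (m + (p ^ k - 1)) choose Suc (p ^ k - 1)) =
      Suc (m + (p ^ k - 1)) * ((m + (p ^ k - 1)) choose (p ^ k - 1))"
    by (rule Suc_times_binomial)
  moreover have "Suc (p ^ k - 1) = p ^ k" "Suc (m + (p ^ k - 1)) = m + p ^ k" using q by simp_all
  ultimately have "p ^ k dvd (m + p ^ k) * ((m + (p ^ k - 1)) choose (p ^ k - 1))"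
    by (metis dvd_triv_left)
  moreover have "coprime (p ^ k) ((m + (p ^ k - 1)) choose (p ^ k - 1))"
    using n p by (simp add: prime_imp_coprime)
  ultimately have "p ^ k dvd m + p ^ k"
    by (simp add: coprime_dvd_mult_left_iff)
  then show False using m by simp
qed

text \<open>
  For \<open>q\<close> a power of a prime \<open>p\<close>, this is divisible by \<open>p\<close> except possibly at vectors that vanish
  modulo \<open>q\<close>, and it is 1 at the zero vector. Its degree as a polynomial is at most \<open>3(q - 1)\<close>.
\<close>

definition zero_indicator :: "nat \<Rightarrow> nat3 \<Rightarrow> int" where
  "zero_indicator q v = int ((fst v + (q - 1)) choose (q - 1)) *
     (int ((fst (snd v) + (q - 1)) choose (q - 1)) * int ((snd (snd v) + (q - 1)) choose (q - 1)))"

lemma degree_below_zero_indicator: 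
  "degree_below (3 * (q - 1) + 1) (zero_indicator q)"
proof -
  have "degree_below (Suc ((q - 1) + ((q - 1) + (q - 1)))) (zero_indicator q)"
    unfolding zero_indicator_def
    by (intro degree_below_mult degree_below_binomial) simp_all
  moreover have "Suc ((q - 1) + ((q - 1) + (q - 1))) = 3 * (q - 1) + 1" by simp
  ultimately show ?thesis by (simp only:)
qed

lemma dvd_zero_indicator:
  assumes "prime p" "\<not> zero_mod (p ^ k) v"
  shows "int p dvd zero_indicator (p ^ k) v"
  using assms prime_dvd_binomial_unless_dvd[OF assms(1), of k]
  unfolding zero_mod_def zero_indicator_def by (meson dvd_mult dvd_mult2 of_nat_dvd_iff)

text \<open>
  If only the empty subset had sum zero, the alternating sum of the indicator over all subsets would
  be 1 modulo \<open>p\<close>, but it vanishes by the degree bound. The length bound is trivial, since a family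
  of exactly \<open>3(q - 1) + 1\<close> vectors can be used.
\<close>

lemma short_zero_sums_prime_power:
  assumes p: "prime p"
  shows "short_zero_sums (p ^ k) (3 * (p ^ k - 1) + 1) (3 * (p ^ k - 1) + 1)"
  unfolding short_zero_sums_def
proof (intro allI impI)
  fix a :: "nat \<Rightarrow> nat3" and I0 :: "nat set"
  let ?q = "p ^ k"
  assume "finite I0" "card I0 \<ge> 3 * (?q - 1) + 1"
  then obtain I where I: "I \<subseteq> I0" "card I = 3 * (?q - 1) + 1" "finite I"
    by (meson obtain_subset_with_card_n finite_subset)
  have "\<exists>X\<subseteq>I. X \<noteq> {} \<and> zero_mod ?q (sum a X)"
  proof (rule ccontr)
    assume non: "\<not> ?thesis"
    have "(\<Sum>X\<in>Pow I. (-1) ^ card X * zero_indicator ?q (sum a X)) = 0"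
      using I by (intro alternating_sum_eq_0[OF degree_below_zero_indicator]) auto
    moreover have "(\<Sum>X\<in>Pow I. (-1) ^ card X * zero_indicator ?q (sum a X)) =
       1 + (\<Sum>X\<in>Pow I - {{}}. (-1) ^ card X * zero_indicator ?q (sum a X))"
      using I by (subst sum.remove[of _ "{}"]) (auto simp: zero_indicator_def)
    moreover have "int p dvd (\<Sum>X\<in>Pow I - {{}}. (-1) ^ card X * zero_indicator ?q (sum a X))"
      using non by (intro dvd_sum dvd_mult dvd_zero_indicator[OF p]) auto
    ultimately have "int p dvd - 1"
      by (simp only: add_eq_0_iff)
    then show False using p by auto
  qed
  then obtain X where X: "X \<subseteq> I" "X \<noteq> {}" "zero_mod ?q (sum a X)" by blast
  then have "card X \<le> 3 * (?q - 1) + 1"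
    using card_mono[OF I(3), of X] I by simp
  then show "\<exists>X\<subseteq>I0. X \<noteq> {} \<and> card X \<le> 3 * (?q - 1) + 1 \<and> zero_mod ?q (sum a X)"
    using X I by blast
qed

text \<open>
  Splitting off the full power \<open>q\<close> of one prime multiplies the bounds. The inequality needed
  is \<open>(3q' + 1)(w m' + 1) \<le> 3 w ((q' + 1)(m' + 1) - 1) + 1\<close> for \<open>w \<ge> 1\<close>, where \<open>q' = q - 1\<close>
  and \<open>m' = m - 1\<close> and \<open>w\<close> is 3 to the number of primes dividing \<open>m\<close>.
\<close>

lemma short_zero_sums_omega:
  "n > 0 \<Longrightarrow> \<exists>l. short_zero_sums n l (3 ^ card (prime_factors n) * (n - 1) + 1)"
proof (induction n rule: less_induct)
  case (less n)
  show ?case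
  proof (cases "n = 1")
    case True
    then show ?thesis using short_zero_sums_one by auto
  next
    case False
    then obtain p where p: "prime p" "p dvd n" using prime_factor_nat by blast
    define k where "k = multiplicity p n"
    obtain m where m: "n = p ^ k * m" "\<not> p dvd m"
      using multiplicity_decompose'[of n p] less.prems p unfolding k_def by (metis not_prime_unit gr0_implies_Suc old.nat.distinct(2))
    have k: "k > 0" using p less.prems unfolding k_def by (simp add: prime_multiplicity_gt_zero_iff)
    let ?q = "p ^ k"
    have q: "?q > 1" using p(1) k prime_gt_1_nat by (intro one_less_power) auto
    have m0: "m > 0" "m < n" using m q less.prems by auto
    have "prime_factors n = insert p (prime_factors m)"
      using m(1) m0 q k p
      by (simp add: prime_factors_product prime_factorization_prime_power)
    moreover have "p \<notin> prime_factors m" using m by auto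
    ultimately have w: "card (prime_factors n) = Suc (card (prime_factors m))" by simp
    define w' where "w' = (3::nat) ^ card (prime_factors m)"
    obtain l where l: "short_zero_sums m l (w' * (m - 1) + 1)"
      using less.IH[OF m0(2) m0(1)] unfolding w'_def by blast
    have w1: "w' \<ge> 1" unfolding w'_def by simp
    obtain m' q' where mq: "m = Suc m'" "?q = Suc q'" using m0 q by (metis gr0_implies_Suc less_trans zero_less_one)
    have "short_zero_sums (?q * m) ((3 * (?q - 1) + 1) * l) ((3 * (?q - 1) + 1) * ((w' * (m - 1) + 1) - 1) + (3 * (?q - 1) + 1))"
      by (rule short_zero_sums_mult[OF short_zero_sums_prime_power[OF p(1)] l]) simp
    moreover have "(3 * (?q - 1) + 1) * ((w' * (m - 1) + 1) - 1) + (3 * (?q - 1) + 1) \<le>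
      3 * w' * (?q * m - 1) + 1"
    proof -
      have "q' \<le> w' * q'" using w1 by simp
      then have "w' * m' + 3 * q' \<le> 3 * (w' * m') + 3 * (w' * q')" by linarith
      then show ?thesis unfolding mq by (simp add: algebra_simps)
    qed
    ultimately show ?thesis
      unfolding w m(1)[symmetric] power_Suc w'_def[symmetric]
      using short_zero_sums_mono by blast
  qed
qed

section \<open>Zero sums of length p in an affine plane\<close>

text \<open>
  In the sum of the squares of the binomial coefficients \<open>p choose k\<close>, only the two outer terms
  are not divisible by \<open>p\<close>.
\<close>

lemma prime_dvd_central_binomial_minus_2:
  assumes p: "prime p"
  shows "int p dvd int ((2 * p) choose p) - 2"
proof -
  have p0: "p > 0" using p prime_gt_0_nat by blast
  have "(2 * p) choose p = (\<Sum>k\<le>p. (p choose k)\<^sup>2)"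
    using choose_square_sum[of p] by simp
  also have "{..p} = insert 0 (insert p {0<..<p})" using p0 by auto
  also have "(\<Sum>k\<in>insert 0 (insert p {0<..<p}). (p choose k)\<^sup>2) = 2 + (\<Sum>k\<in>{0<..<p}. (p choose k)\<^sup>2)"
    using p0 by simp
  finally have "int ((2 * p) choose p) - 2 = int (\<Sum>k\<in>{0<..<p}. (p choose k)\<^sup>2)" by simp
  moreover have "p dvd (\<Sum>k\<in>{0<..<p}. (p choose k)\<^sup>2)"
    using p by (intro dvd_sum) (auto simp: power2_eq_square intro!: dvd_mult dvd_choose_prime)
  ultimately show ?thesis by (metis of_nat_dvd_iff)
qed

text \<open>
  The last coordinate counts the terms, so that sums over a subset also record its size.
\<close>

definition labelled :: "(nat \<Rightarrow> nat) \<Rightarrow> (nat \<Rightarrow> nat) \<Rightarrow> nat \<Rightarrow> nat3" where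
  "labelled x y i = (x i, y i, 1)"

lemma zero_mod_labelled:
  "zero_mod p (sum (labelled x y) X) \<longleftrightarrow> p dvd sum x X \<and> p dvd sum y X \<and> p dvd card X"
  by (simp add: zero_mod_def labelled_def fst_sum snd_sum)

text \<open>
  Dropping one index leaves \<open>3p - 1\<close> labelled vectors, so by Olson's theorem there is a proper
  zero sum whose length is divisible by \<open>p\<close>. It has length \<open>p\<close>, or its complement has.
\<close>

lemma zero_sum_of_length_3p_splits:
  fixes X :: "nat set"
  assumes p: "prime p" and X: "card X = 3 * p" "p dvd sum x X" "p dvd sum y X"
  shows "\<exists>Z\<subseteq>X. card Z = p \<and> p dvd sum x Z \<and> p dvd sum y Z"
proof -
  have p0: "p > 0" using p prime_gt_0_nat by blast
  have finX: "finite X" using X(1) p0 by (intro card_ge_0_finite) simp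
  obtain i where i: "i \<in> X" using X(1) p0 by fastforce
  have "card (X - {i}) \<ge> 3 * (p - 1) + 1" using X(1) i finX p0 by simp
  then obtain Z where Z: "Z \<subseteq> X - {i}" "Z \<noteq> {}" "zero_mod p (sum (labelled x y) Z)"
    using short_zero_sums_prime_power[OF p, of 1, unfolded short_zero_sums_def, rule_format, of "X - {i}" "labelled x y"] finX
    by auto
  have ZX: "Z \<subset> X" using Z(1) i by blast
  then have cZ: "card Z < 3 * p" "card Z > 0" using finX X(1) Z(2) psubset_card_mono[OF finX ZX] 
    by (auto simp: card_gt_0_iff finite_subset)
  from Z(3) have dZ: "p dvd sum x Z" "p dvd sum y Z" "p dvd card Z" unfolding zero_mod_labelled by auto
  then obtain k where k: "card Z = p * k" by blast
  have "k < 3" "k > 0" using cZ k p0 by (auto simp: mult.commute)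
  then have "k = 1 \<or> k = 2" by auto
  then show ?thesis
  proof
    assume "k = 1"
    then show ?thesis using k dZ ZX by auto
  next
    assume k2: "k = 2"
    have split: "sum f X = sum f (X - Z) + sum f Z" for f :: "nat \<Rightarrow> nat"
      using ZX finX by (intro sum.subset_diff) auto
    have "card (X - Z) = p" using k k2 ZX X(1) finX by (subst card_Diff_subset) (auto intro: finite_subset)
    moreover have "p dvd sum x (X - Z)" "p dvd sum y (X - Z)"
      using X(2,3) dZ unfolding split[of x] split[of y] by (simp_all add: dvd_add_left_iff)
    ultimately show ?thesis by blast
  qed
qed

text \<open>
  Multiplying the indicator for labelled vectors by \<open>(s choose p) - 2\<close>, where \<open>s\<close> is the size of
  the subset, makes the subsets of size \<open>2p\<close> irrelevant modulo \<open>p\<close>, at the price of raising the degree by \<open>p\<close>. The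
  subsets of size \<open>p\<close> and \<open>3p\<close> are excluded by assumption and by \<open>zero_sum_of_length_3p_splits\<close>, and the
  empty subset contributes \<open>-2\<close>, which is nonzero modulo an odd \<open>p\<close>.
\<close>

lemma zero_sum_of_length_p_in_plane:
  fixes I0 :: "nat set"
  assumes p: "prime p" "p \<noteq> 2" and I0: "finite I0" "card I0 \<ge> 4 * p - 2"
  shows "\<exists>X\<subseteq>I0. card X = p \<and> p dvd sum x X \<and> p dvd sum y X"
proof (rule ccontr)
  assume non: "\<not> ?thesis"
  obtain I where I: "I \<subseteq> I0" "card I = 4 * p - 2" "finite I"
    using I0 by (meson obtain_subset_with_card_n finite_subset)
  have p0: "p > 0" using p prime_gt_0_nat by blast
  define f where "f = (\<lambda>v :: nat3. zero_indicator p v * (int (snd (snd v) choose p) + (- 2)))"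
  have "degree_below (Suc p) (\<lambda>v :: nat3. int ((snd (snd v) + 0) choose p))"
    by (rule degree_below_binomial) simp
  then have "degree_below (Suc p) (\<lambda>v :: nat3. int (snd (snd v) choose p) + (- 2))"
    using degree_below_const[of p "-2"] by (intro degree_below_add) simp_all
  then have "degree_below (Suc (3 * (p - 1) + p)) f"
    unfolding f_def using degree_below_zero_indicator[of p]
    by (intro degree_below_mult) (simp_all only: Suc_eq_plus1)
  then have "(\<Sum>X\<in>Pow I. (-1) ^ card X * f (sum (labelled x y) X)) = 0"
    by (rule alternating_sum_eq_0) (use I p0 in simp_all)
  moreover have "(\<Sum>X\<in>Pow I. (-1) ^ card X * f (sum (labelled x y) X)) =
      - 2 + (\<Sum>X\<in>Pow I - {{}}. (-1) ^ card X * f (sum (labelled x y) X))"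
    using I p0 by (subst sum.remove[of _ "{}"]) (auto simp: f_def zero_indicator_def)
  moreover have "int p dvd (\<Sum>X\<in>Pow I - {{}}. (-1) ^ card X * f (sum (labelled x y) X))"
  proof (intro dvd_sum dvd_mult)
    fix X assume X: "X \<in> Pow I - {{}}"
    then have finX: "finite X" using I by (auto intro: finite_subset)
    show "int p dvd f (sum (labelled x y) X)"
    proof (cases "zero_mod p (sum (labelled x y) X)")
      case False
      then show ?thesis using dvd_zero_indicator[OF p(1), of 1] unfolding f_def by simp
    next
      case True
      then have dX: "p dvd sum x X" "p dvd sum y X" "p dvd card X" unfolding zero_mod_labelled by auto
      then obtain k where k: "card X = p * k" by blast
      have "card X \<le> 4 * p - 2" using X I card_mono[OF I(3), of X] by auto
      then have "p * k < p * 4" using k p0 by linarith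
      then have "k < 4" by simp
      moreover have "k \<noteq> 0" using k X finX by auto
      moreover have "k \<noteq> 1" using non dX k X I by auto
      moreover have "k \<noteq> 3"
        using non zero_sum_of_length_3p_splits[OF p(1), of X x y] dX k X I by (auto simp: mult.commute)
      ultimately have "k = 2" by linarith
      then have "card X = 2 * p" using k by simp
      then have "snd (snd (sum (labelled x y) X)) = 2 * p" by (simp add: snd_sum labelled_def)
      then show ?thesis
        unfolding f_def using prime_dvd_central_binomial_minus_2[OF p(1)] by (intro dvd_mult) simp
    qed
  qed
  ultimately have "int p dvd 2"
    by (simp only: add_eq_0_iff minus_minus) 
  then have "p dvd 2" by (metis of_nat_dvd_iff of_nat_numeral)
  then show False using p primes_dvd_imp_eq two_is_prime_nat by blast
qed

section \<open>Residues modulo p in dimension three\<close>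

type_synonym int3 = "int \<times> int \<times> int"

fun dot :: "int3 \<Rightarrow> int3 \<Rightarrow> int" where
  "dot (k1, k2, k3) (v1, v2, v3) = k1 * v1 + k2 * v2 + k3 * v3"

lemma dot_add: "dot k (v + w) = dot k v + dot k w"
  by (cases k; cases v; cases w) (simp add: algebra_simps)

lemma dot_diff: "dot k (v - w) = dot k v - dot k w"
  by (cases k; cases v; cases w) (simp add: algebra_simps)

lemma dot_zero: "dot k 0 = 0" "dot 0 v = 0"
  by (cases k; cases v; simp add: zero_prod_def)+

definition residue_box :: "nat \<Rightarrow> int3 set" where
  "residue_box p = {0..<int p} \<times> {0..<int p} \<times> {0..<int p}"

fun cong_zero :: "nat \<Rightarrow> int3 \<Rightarrow> bool" where
  "cong_zero p (x, y, z) \<longleftrightarrow> int p dvd x \<and> int p dvd y \<and> int p dvd z"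

lemma cong_zero_0 [simp]: "cong_zero p 0"
  by (simp add: zero_prod_def)

lemma cong_zero_add: "cong_zero p v \<Longrightarrow> cong_zero p w \<Longrightarrow> cong_zero p (v + w)"
  by (cases v; cases w) simp

lemma cong_zero_minus: "cong_zero p (v - w) \<longleftrightarrow> cong_zero p (w - v)"
  by (cases v; cases w) (simp add: dvd_diff_commute)

lemma cong_zero_dot: "cong_zero p v \<Longrightarrow> int p dvd dot k v"
  by (cases v; cases k) auto

lemma finite_residue_box [simp]: "finite (residue_box p)"
  by (simp add: residue_box_def)

lemma card_residue_box: "card (residue_box p) = p ^ 3"
  by (simp add: residue_box_def card_cartesian_product power3_eq_cube)

text \<open>
  Sets of residue vectors modulo \<open>p\<close> are represented by their periodic preimages in \<open>\<int>\<^sup>3\<close>, so that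
  translation needs no reduction. Only counting refers to the fundamental domain \<open>residue_box\<close>.
\<close>

definition periodic :: "nat \<Rightarrow> int3 set \<Rightarrow> bool" where
  "periodic p Y \<longleftrightarrow> (\<forall>v u. cong_zero p u \<longrightarrow> (v + u \<in> Y \<longleftrightarrow> v \<in> Y))"

lemma periodicD: "periodic p Y \<Longrightarrow> cong_zero p (v - w) \<Longrightarrow> v \<in> Y \<longleftrightarrow> w \<in> Y"
  unfolding periodic_def by (metis add.commute diff_add_cancel)

definition size_mod :: "nat \<Rightarrow> int3 set \<Rightarrow> nat" where
  "size_mod p Y = card (Y \<inter> residue_box p)"

definition reduce :: "nat \<Rightarrow> int3 \<Rightarrow> int3" where
  "reduce p v = (fst v mod int p, fst (snd v) mod int p, snd (snd v) mod int p)"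

lemma reduce_in_residue_box: "p > 0 \<Longrightarrow> reduce p v \<in> residue_box p"
  by (simp add: reduce_def residue_box_def)

lemma cong_zero_reduce: "cong_zero p (v - reduce p v)"
  by (cases v) (auto simp: reduce_def minus_mod_eq_mult_div)

lemma eq_mod_imp_eq:
  "x \<in> {0..<int p} \<Longrightarrow> y \<in> {0..<int p} \<Longrightarrow> int p dvd x - y \<Longrightarrow> x = y"
  by (metis atLeastLessThan_iff mod_eq_dvd_iff mod_pos_pos_trivial)

lemma residue_box_eqI: "v \<in> residue_box p \<Longrightarrow> w \<in> residue_box p \<Longrightarrow> cong_zero p (v - w) \<Longrightarrow> v = w"
  by (cases v; cases w) (auto simp: residue_box_def intro: eq_mod_imp_eq)

lemma bij_betw_shift_residue_box:
  assumes p: "p > 0"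
  shows "bij_betw (\<lambda>v. reduce p (v + a)) (residue_box p) (residue_box p)"
proof -
  have inj: "inj_on (\<lambda>v. reduce p (v + a)) (residue_box p)"
  proof (rule inj_onI)
    fix v w assume vw: "v \<in> residue_box p" "w \<in> residue_box p" "reduce p (v + a) = reduce p (w + a)"
    have "cong_zero p ((v + a - reduce p (v + a)) + (reduce p (w + a) - (w + a)))"
      using cong_zero_reduce cong_zero_minus by (intro cong_zero_add) blast+
    then have "cong_zero p (v - w)" unfolding vw(3) by (simp add: algebra_simps)
    then show "v = w" using vw residue_box_eqI by blast
  qed
  have "(\<lambda>v. reduce p (v + a)) ` residue_box p \<subseteq> residue_box p"
    by (intro image_subsetI reduce_in_residue_box p)
  then show ?thesis using inj endo_inj_surj[OF finite_residue_box] by (simp add: bij_betw_def)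
qed

lemma card_shift:
  assumes p: "p > 0" and Q: "\<And>v u. cong_zero p u \<Longrightarrow> Q (v + u) \<longleftrightarrow> Q v"
  shows "card {v \<in> residue_box p. Q (v + a)} = card {v \<in> residue_box p. Q v}"
proof -
  have Qr: "Q (reduce p v) \<longleftrightarrow> Q v" for v
    using Q[of "v - reduce p v" "reduce p v"] cong_zero_reduce by (metis add.commute diff_add_cancel)
  have "bij_betw (\<lambda>v. reduce p (v + a)) {v \<in> residue_box p. Q (v + a)} {v \<in> residue_box p. Q v}"
  proof (rule bij_betw_subset[OF bij_betw_shift_residue_box[OF p], of _ a])
    have "(\<lambda>v. reduce p (v + a)) ` residue_box p = residue_box p"
      using bij_betw_shift_residue_box[OF p] bij_betw_imp_surj_on by blast
    moreover have "(\<lambda>v. reduce p (v + a)) ` {v \<in> residue_box p. Q (v + a)} =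
        {w \<in> (\<lambda>v. reduce p (v + a)) ` residue_box p. Q w}"
      using Qr by blast
    ultimately show "(\<lambda>v. reduce p (v + a)) ` {v \<in> residue_box p. Q (v + a)} = {v \<in> residue_box p. Q v}"
      by simp
  qed auto
  then show ?thesis by (rule bij_betw_same_card)
qed

section \<open>Growth of a periodic set under translation\<close>

text \<open>
  The number of residue vectors that \<open>Y \<union> (a + Y)\<close> has in addition to those of \<open>Y\<close>.
\<close>

definition growth :: "nat \<Rightarrow> int3 set \<Rightarrow> int3 \<Rightarrow> nat" where
  "growth p Y a = card {v \<in> residue_box p. v \<in> Y \<and> v + a \<notin> Y}"

text \<open>
  A point that leaves \<open>Y\<close> under translation by \<open>a + b\<close> leaves it under \<open>a\<close>, or else its
  translate by \<open>a\<close> leaves \<open>Y\<close> under \<open>b\<close>.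
\<close>

lemma growth_subadd:
  assumes p: "p > 0" and Y: "periodic p Y"
  shows "growth p Y (a + b) \<le> growth p Y a + growth p Y b"
proof -
  have per: "v + u + b \<in> Y \<longleftrightarrow> v + b \<in> Y" if "cong_zero p u" for v u
    using periodicD[OF Y, of "v + u + b" "v + b"] that by (simp add: algebra_simps)
  have "{v \<in> residue_box p. v \<in> Y \<and> v + (a + b) \<notin> Y} \<subseteq>
     {v \<in> residue_box p. v \<in> Y \<and> v + a \<notin> Y} \<union> {v \<in> residue_box p. v + a \<in> Y \<and> v + a + b \<notin> Y}"
    by (auto simp: add.assoc)
  then have "growth p Y (a + b) \<le> card ({v \<in> residue_box p. v \<in> Y \<and> v + a \<notin> Y} \<union> {v \<in> residue_box p. v + a \<in> Y \<and> v + a + b \<notin> Y})"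
    unfolding growth_def by (intro card_mono) auto
  also have "\<dots> \<le> growth p Y a + card {v \<in> residue_box p. v + a \<in> Y \<and> v + a + b \<notin> Y}"
    unfolding growth_def by (rule card_Un_le)
  also have "card {v \<in> residue_box p. v + a \<in> Y \<and> v + a + b \<notin> Y} = growth p Y b"
    unfolding growth_def
    by (rule card_shift[OF p, of "\<lambda>v. v \<in> Y \<and> v + b \<notin> Y"]) (use Y per in \<open>auto simp: periodic_def\<close>)
  finally show ?thesis .
qed

fun multiple :: "nat \<Rightarrow> int3 \<Rightarrow> int3" where
  "multiple j (x, y, z) = (int j * x, int j * y, int j * z)"

lemma dot_multiple: "dot k (multiple j v) = int j * dot k v"
  by (cases k; cases v) (simp add: algebra_simps)

lemma growth_multiple:
  assumes "p > 0" "periodic p Y"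
  shows "growth p Y (multiple j a) \<le> j * growth p Y a"
proof (induction j)
  case 0
  have "multiple 0 a = 0" by (cases a) (simp add: zero_prod_def)
  then show ?case by (simp add: growth_def)
next
  case (Suc j)
  have "multiple (Suc j) a = a + multiple j a" by (cases a) (simp add: algebra_simps)
  then show ?case using growth_subadd[OF assms, of a "multiple j a"] Suc by simp
qed

section \<open>Growth from characters\<close>

text \<open>
  The characters of the residue vectors are the maps \<open>v \<mapsto> unit_root p (dot k v)\<close> for \<open>k\<close> in
  \<open>residue_box p\<close>.
\<close>

definition unit_root :: "nat \<Rightarrow> int \<Rightarrow> complex" where
  "unit_root p k = cis (2 * pi * real_of_int k / real p)"

lemma unit_root_add: "unit_root p (k + l) = unit_root p k * unit_root p l"
  by (simp add: unit_root_def cis_mult ring_distribs add_divide_distrib)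

lemma unit_root_0 [simp]: "unit_root p 0 = 1"
  by (simp add: unit_root_def)

lemma unit_root_minus: "unit_root p (- k) = cnj (unit_root p k)"
  by (simp add: unit_root_def cis_cnj)

lemma unit_root_eq_1: 
  assumes "p > 0"
  shows "unit_root p m = 1 \<longleftrightarrow> int p dvd m"
proof
  assume "unit_root p m = 1"
  then have "cos (2 * pi * real_of_int m / real p) = 1"
    by (simp add: unit_root_def complex_eq_iff)
  then obtain n :: int where "2 * pi * real_of_int m / real p = n * 2 * pi"
    by (auto simp: cos_one_2pi_int)
  then have "real_of_int m = real_of_int (n * int p)" using assms by (simp add: field_simps)
  then have "m = n * int p" by linarith
  then show "int p dvd m" by simp
next
  assume "int p dvd m"
  then obtain n where "m = int p * n" by blast
  then have "2 * pi * real_of_int m / real p = 2 * pi * real_of_int n" using assms by simp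
  then show "unit_root p m = 1" by (simp add: unit_root_def complex_eq_iff cos_int_2pin sin_int_2pin)
qed

lemma unit_root_power: "unit_root p (int j * m) = unit_root p m ^ j"
  by (induction j) (simp_all add: unit_root_add ring_distribs)

lemma sum_unit_root:
  assumes p: "p > 0"
  shows "(\<Sum>k\<in>{0..<int p}. unit_root p (k * m)) = (if int p dvd m then of_nat p else 0)"
proof -
  have "{0..<int p} = int ` {..<p}" by (simp add: image_int_atLeastLessThan lessThan_atLeast0)
  then have eq: "(\<Sum>k\<in>{0..<int p}. unit_root p (k * m)) = (\<Sum>j<p. unit_root p m ^ j)"
    by (simp add: sum.reindex unit_root_power)
  show ?thesis
  proof (cases "int p dvd m")
    case True
    then have "unit_root p m = 1" using unit_root_eq_1 p by simp
    then show ?thesis using True eq by simp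
  next
    case False
    then have "unit_root p m \<noteq> 1" using unit_root_eq_1 p by simp
    moreover have "unit_root p m ^ p = 1" using unit_root_power[of p p m] unit_root_eq_1[OF p] by (metis dvd_triv_left)
    ultimately show ?thesis using False eq by (simp add: sum_gp_strict)
  qed
qed

lemma sum_residue_box_unit_root:
  assumes p: "p > 0"
  shows "(\<Sum>k\<in>residue_box p. unit_root p (dot k v)) = (if cong_zero p v then of_nat p ^ 3 else 0)"
proof -
  obtain x y z where v: "v = (x, y, z)" by (cases v)
  have "(\<Sum>k\<in>residue_box p. unit_root p (dot k v)) =
     (\<Sum>k1\<in>{0..<int p}. \<Sum>k2\<in>{0..<int p}. \<Sum>k3\<in>{0..<int p}. unit_root p (k1 * x) * (unit_root p (k2 * y) * unit_root p (k3 * z)))"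
    unfolding residue_box_def v by (simp add: sum.cartesian_product' unit_root_add mult.assoc)
  also have "\<dots> = (\<Sum>k1\<in>{0..<int p}. unit_root p (k1 * x)) * ((\<Sum>k2\<in>{0..<int p}. unit_root p (k2 * y)) * (\<Sum>k3\<in>{0..<int p}. unit_root p (k3 * z)))"
    by (simp only: sum_product) (simp only: sum_distrib_left)
  also have "\<dots> = (if cong_zero p v then of_nat p ^ 3 else 0)"
    unfolding sum_unit_root[OF p] v by (auto simp: power3_eq_cube)
  finally show ?thesis .
qed

definition fourier :: "nat \<Rightarrow> int3 set \<Rightarrow> int3 \<Rightarrow> complex" where
  "fourier p Y k = (\<Sum>v\<in>Y \<inter> residue_box p. unit_root p (dot k v))"

text \<open>
  Parseval's identity for \<open>Y\<close> and its translate: expanding the square and summing over \<open>k\<close>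
  leaves, by orthogonality, the pairs of points of \<open>Y\<close> that differ by \<open>a\<close>.
\<close>

lemma fourier_correlation:
  assumes p: "p > 0" and Y: "periodic p Y"
  shows "(\<Sum>k\<in>residue_box p. (norm (fourier p Y k))\<^sup>2 * Re (unit_root p (dot k a)))
     = real p ^ 3 * real (card {v \<in> residue_box p. v \<in> Y \<and> v + a \<in> Y})"
proof -
  let ?B = "Y \<inter> residue_box p"
  have "(\<Sum>k\<in>residue_box p. fourier p Y k * cnj (fourier p Y k) * unit_root p (dot k a)) =
    (\<Sum>k\<in>residue_box p. \<Sum>v\<in>?B. \<Sum>w\<in>?B. unit_root p (dot k (v + a - w)))"
  proof (rule sum.cong[OF refl])
    fix k
    have "fourier p Y k * cnj (fourier p Y k) * unit_root p (dot k a) =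
       (\<Sum>v\<in>?B. \<Sum>w\<in>?B. unit_root p (dot k v) * cnj (unit_root p (dot k w)) * unit_root p (dot k a))"
      by (simp only: fourier_def cnj_sum sum_product) (simp only: sum_distrib_right)
    also have "\<dots> = (\<Sum>v\<in>?B. \<Sum>w\<in>?B. unit_root p (dot k (v + a - w)))"
      by (intro sum.cong refl) (simp add: dot_diff dot_add unit_root_add unit_root_minus[symmetric] algebra_simps flip: unit_root_add)
    finally show "fourier p Y k * cnj (fourier p Y k) * unit_root p (dot k a) = \<dots>" .
  qed
  also have "\<dots> = (\<Sum>v\<in>?B. \<Sum>w\<in>?B. \<Sum>k\<in>residue_box p. unit_root p (dot k (v + a - w)))"
    by (rule trans[OF sum.swap]) (rule sum.cong[OF refl], rule sum.swap)
  also have "\<dots> = (\<Sum>v\<in>?B. if v + a \<in> Y then of_nat p ^ 3 else 0)"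
  proof (rule sum.cong[OF refl])
    fix v
    have "cong_zero p (v + a - w) \<longleftrightarrow> w = reduce p (v + a)" if "w \<in> ?B" for w
    proof
      assume "cong_zero p (v + a - w)"
      then have "cong_zero p ((v + a - reduce p (v + a)) + (w - (v + a)))"
        using cong_zero_reduce cong_zero_minus by (intro cong_zero_add) blast+
      then have "cong_zero p (w - reduce p (v + a))" by (simp add: algebra_simps)
      then show "w = reduce p (v + a)" using residue_box_eqI reduce_in_residue_box p that by blast
    qed (simp add: cong_zero_reduce)
    moreover have "reduce p (v + a) \<in> ?B \<longleftrightarrow> v + a \<in> Y"
      using periodicD[OF Y cong_zero_reduce] reduce_in_residue_box[OF p] by blast
    ultimately show "(\<Sum>w\<in>?B. \<Sum>k\<in>residue_box p. unit_root p (dot k (v + a - w))) = (if v + a \<in> Y then of_nat p ^ 3 else 0)"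
    proof -
      assume eq: "\<And>w. w \<in> ?B \<Longrightarrow> cong_zero p (v + a - w) \<longleftrightarrow> w = reduce p (v + a)"
        and mem: "reduce p (v + a) \<in> ?B \<longleftrightarrow> v + a \<in> Y"
      have "(\<Sum>w\<in>?B. \<Sum>k\<in>residue_box p. unit_root p (dot k (v + a - w))) =
          (\<Sum>w\<in>?B. if w = reduce p (v + a) then of_nat p ^ 3 else 0)"
        unfolding sum_residue_box_unit_root[OF p] using eq by (intro sum.cong refl) simp
      also have "\<dots> = (if v + a \<in> Y then of_nat p ^ 3 else 0)"
        using mem by (simp add: sum.delta')
      finally show ?thesis .
    qed
  qed
  also have "\<dots> = of_nat p ^ 3 * of_nat (card {v \<in> residue_box p. v \<in> Y \<and> v + a \<in> Y})"
  proof -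
    have "{v \<in> ?B. v + a \<in> Y} = {v \<in> residue_box p. v \<in> Y \<and> v + a \<in> Y}" by auto
    then show ?thesis by (simp add: sum.If_cases Int_def)
  qed
  finally have "(\<Sum>k\<in>residue_box p. fourier p Y k * cnj (fourier p Y k) * unit_root p (dot k a)) = of_real (real p ^ 3 * real (card {v \<in> residue_box p. v \<in> Y \<and> v + a \<in> Y}))"
    by simp
  then have "Re (\<Sum>k\<in>residue_box p. fourier p Y k * cnj (fourier p Y k) * unit_root p (dot k a)) = real p ^ 3 * real (card {v \<in> residue_box p. v \<in> Y \<and> v + a \<in> Y})"
    by (simp only: Re_complex_of_real)
  moreover have "Re (fourier p Y k * cnj (fourier p Y k) * unit_root p (dot k a)) = (norm (fourier p Y k))\<^sup>2 * Re (unit_root p (dot k a))" for k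
    by (simp add: complex_norm_square[symmetric] del: of_real_power)
  ultimately show ?thesis by (simp only: Re_sum)
qed

lemma fourier_growth:
  assumes p: "p > 0" and Y: "periodic p Y"
  shows "real p ^ 3 * real (growth p Y a) =
     (\<Sum>k\<in>residue_box p. (norm (fourier p Y k))\<^sup>2 * (1 - Re (unit_root p (dot k a))))"
proof -
  have "card {v \<in> residue_box p. v \<in> Y} = card {v \<in> residue_box p. v \<in> Y \<and> v + a \<in> Y} + growth p Y a"
    unfolding growth_def by (subst card_Un_disjoint[symmetric]) (auto intro!: arg_cong[of _ _ card])
  then show ?thesis
    using fourier_correlation[OF assms, of 0] fourier_correlation[OF assms, of a]
    by (simp add: right_diff_distrib sum_subtractf dot_zero ring_distribs)
qed

text \<open>
  The trivial character accounts for \<open>|Y|\<^sup>2\<close>; if \<open>Y\<close> fills at most half of the residues, at least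
  half of the Fourier mass therefore sits at nontrivial characters.
\<close>

lemma sum_fourier_nonzero:
  assumes p: "p > 0" and Y: "periodic p Y"
  shows "(\<Sum>k\<in>residue_box p - {0}. (norm (fourier p Y k))\<^sup>2) = real p ^ 3 * real (size_mod p Y) - real (size_mod p Y) ^ 2"
proof -
  have "0 \<in> residue_box p" using p by (simp add: residue_box_def zero_prod_def)
  moreover have "fourier p Y 0 = of_nat (size_mod p Y)" by (simp add: fourier_def dot_zero size_mod_def)
  moreover have "(\<Sum>k\<in>residue_box p. (norm (fourier p Y k))\<^sup>2) = real p ^ 3 * real (size_mod p Y)"
    using fourier_correlation[OF assms, of 0]
    by (simp add: dot_zero size_mod_def Int_def conj_commute)
  ultimately show ?thesis by (subst sum_diff) simp_all
qed

text \<open>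
  A single translation by \<open>a\<close> may be nearly invisible to a character, because \<open>dot k a\<close> can be
  small compared with \<open>p\<close>. Its multiples up to \<open>J * a\<close> are visible as soon as \<open>dot k a\<close> is not
  extremely small, and by subadditivity they grow \<open>Y\<close> at most \<open>J\<close> times as much as \<open>a\<close> does. Averaging
  over all \<open>i\<close> and all multiples gives the bound.
\<close>

lemma exists_growth_of_equidistribution:
  assumes p: "p > 0" and Y: "periodic p Y" "2 * size_mod p Y \<le> p ^ 3" and I: "finite I" "I \<noteq> {}"
    and far: "\<And>k. k \<in> residue_box p \<Longrightarrow> k \<noteq> 0 \<Longrightarrow>
       card I \<le> 2 * card {i \<in> I. (\<Sum>j=1..J. Re (unit_root p (int j * dot k (a i)))) \<le> J / 2}"
    and J: "J \<ge> 1"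
  shows "\<exists>i\<in>I. size_mod p Y \<le> 4 * (J + 1) * growth p Y (a i)"
proof (rule ccontr)
  assume none: "\<not> ?thesis"
  have small: "4 * (real J + 1) * real (growth p Y (a i)) < real (size_mod p Y)" if "i \<in> I" for i
  proof -
    have "4 * (J + 1) * growth p Y (a i) < size_mod p Y"
      using that none by (meson not_le)
    then have "real (4 * (J + 1) * growth p Y (a i)) < real (size_mod p Y)"
      by (simp only: of_nat_less_iff)
    then show ?thesis by (simp add: algebra_simps)
  qed
  let ?E = "\<lambda>k i. \<Sum>j=1..J. 1 - Re (unit_root p (int j * dot k (a i)))"
  have E0: "?E k i \<ge> 0" for k i
    by (intro sum_nonneg) (simp add: unit_root_def)
  have E: "(\<Sum>i\<in>I. ?E k i) \<ge> real (card I) * real J / 4" if "k \<in> residue_box p - {0}" for k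
  proof -
    let ?G = "{i \<in> I. (\<Sum>j=1..J. Re (unit_root p (int j * dot k (a i)))) \<le> J / 2}"
    have "real (card I) / 2 \<le> real (card ?G)" using far[of k] that by simp
    then have "real (card I) / 2 * (real J / 2) \<le> real (card ?G) * (real J / 2)"
      by (rule mult_right_mono) simp
    also have "\<dots> = (\<Sum>i\<in>?G. real J / 2)" by simp
    also have "\<dots> \<le> (\<Sum>i\<in>?G. ?E k i)" by (intro sum_mono) (auto simp: sum_subtractf)
    also have "\<dots> \<le> (\<Sum>i\<in>I. ?E k i)" using I E0 by (intro sum_mono2) auto
    finally show ?thesis by simp
  qed
  let ?f = "\<lambda>k. (norm (fourier p Y k))\<^sup>2"
  let ?N = "real p ^ 3" and ?y = "real (size_mod p Y)"
  have "?N * ?y / 2 \<le> ?N * ?y - ?y\<^sup>2"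
  proof -
    have "2 * ?y \<le> ?N" using Y(2) by (metis of_nat_le_iff of_nat_mult of_nat_numeral of_nat_power)
    then have "2 * ?y * ?y \<le> ?N * ?y" by (intro mult_right_mono) auto
    then show ?thesis by (simp add: power2_eq_square algebra_simps)
  qed
  then have "?N * ?y / 2 * (real (card I) * real J / 4) \<le> (\<Sum>k\<in>residue_box p - {0}. ?f k) * (real (card I) * real J / 4)"
    unfolding sum_fourier_nonzero[OF p Y(1)] by (rule mult_right_mono) simp
  also have "\<dots> \<le> (\<Sum>k\<in>residue_box p - {0}. ?f k * (\<Sum>i\<in>I. ?E k i))"
    unfolding sum_distrib_right using E by (intro sum_mono mult_left_mono) auto
  also have "\<dots> \<le> (\<Sum>k\<in>residue_box p. ?f k * (\<Sum>i\<in>I. ?E k i))"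
    by (intro sum_mono2 mult_nonneg_nonneg sum_nonneg[of I] E0) auto
  also have "\<dots> = (\<Sum>k\<in>residue_box p. \<Sum>i\<in>I. \<Sum>j=1..J. ?f k * (1 - Re (unit_root p (dot k (multiple j (a i))))))"
    by (simp only: sum_distrib_left dot_multiple)
  also have "\<dots> = (\<Sum>i\<in>I. \<Sum>j=1..J. \<Sum>k\<in>residue_box p. ?f k * (1 - Re (unit_root p (dot k (multiple j (a i))))))"
    by (rule trans[OF sum.swap]) (rule sum.cong[OF refl], rule sum.swap)
  also have "\<dots> = (\<Sum>i\<in>I. \<Sum>j=1..J. ?N * real (growth p Y (multiple j (a i))))"
    by (simp only: fourier_growth[OF p Y(1)])
  also have "\<dots> \<le> (\<Sum>i\<in>I. \<Sum>j=1..J. ?N * (real j * real (growth p Y (a i))))"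
    using growth_multiple[OF p Y(1)] by (intro sum_mono mult_left_mono) (simp_all flip: of_nat_mult)
  also have "\<dots> = (\<Sum>i\<in>I. ?N * (real J * (real J + 1) / 2) * real (growth p Y (a i)))"
  proof -
    have "(\<Sum>j=1..J. real j) = real J * (real J + 1) / 2" by (induction J) (auto simp: field_simps)
    moreover have "(\<Sum>j=1..J. ?N * (real j * g)) = ?N * (\<Sum>j=1..J. real j) * g" for g
      by (simp only: sum_distrib_left sum_distrib_right mult.assoc)
    ultimately show ?thesis by (simp only:)
  qed
  also have "\<dots> < (\<Sum>i\<in>I. ?N * real J / 8 * ?y)"
  proof (rule sum_strict_mono[OF I])
    fix i assume "i \<in> I"
    then have "?N * real J / 8 * (4 * (real J + 1) * real (growth p Y (a i))) < ?N * real J / 8 * ?y"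
      using small p J by (intro mult_strict_left_mono) auto
    then show "?N * (real J * (real J + 1) / 2) * real (growth p Y (a i)) < ?N * real J / 8 * ?y"
      by (simp add: field_simps)
  qed
  also have "\<dots> = ?N * ?y / 2 * (real (card I) * real J / 4)" by simp
  finally show False by simp
qed

lemma sin_ge_half:
  assumes "0 \<le> x" "x \<le> (pi / 3 :: real)"
  shows "x / 2 \<le> sin x"
proof -
  have "sin 0 - 0 / 2 \<le> sin x - x / 2"
  proof (rule DERIV_nonneg_imp_nondecreasing[OF assms(1), of "\<lambda>t. sin t - t / 2"])
    fix t assume t: "0 \<le> t" "t \<le> x"
    have "cos (pi / 3) \<le> cos t" using t assms by (intro cos_monotone_0_pi_le) auto
    then show "\<exists>y. ((\<lambda>t. sin t - t / 2) has_real_derivative y) (at t) \<and> 0 \<le> y"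
      by (intro exI[of _ "cos t - 1 / 2"]) (auto intro!: derivative_eq_intros simp: cos_60)
  qed
  then show ?thesis by simp
qed

text \<open>
  The geometric sum is at most \<open>2 / |1 - z|\<close> for the root of unity \<open>z\<close> concerned, and
  \<open>|1 - z|\<close> is at least \<open>2w/p\<close> when the residue \<open>t\<close> has distance at least \<open>w\<close> from \<open>0\<close> modulo \<open>p\<close>.
\<close>

lemma cos_sum_bound:
  fixes t :: int
  assumes p: "p > 0" and w: "3 * w \<le> p" "w > 0" and t: "int w \<le> t mod int p" "t mod int p \<le> int p - int w"
  shows "(\<Sum>j=1..J. Re (unit_root p (int j * t))) \<le> real p / real w"
proof -
  define s where "s = t mod int p"
  let ?x = "pi * real_of_int s / real p"
  have s: "real w \<le> real_of_int s" "real_of_int s \<le> real p - real w" using t unfolding s_def by linarith+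
  have et: "unit_root p t = unit_root p s"
  proof -
    have "unit_root p t = unit_root p (s + int p * (t div int p))" by (simp add: s_def)
    also have "\<dots> = unit_root p s" using unit_root_eq_1[OF p] by (simp add: unit_root_add)
    finally show ?thesis .
  qed
  let ?y = "pi * real w / real p"
  have y: "0 \<le> ?y" "?y \<le> pi / 3" using w p by (auto simp: field_simps)
  have y': "- (pi / 2) \<le> ?y" using y(1) pi_gt_zero by linarith
  have xy: "?y \<le> ?x" "?x \<le> pi - ?y"
  proof -
    show "?y \<le> ?x" using s p by (intro divide_right_mono mult_left_mono) auto
    have "?x \<le> pi * (real p - real w) / real p" using s p by (intro divide_right_mono mult_left_mono) auto
    then show "?x \<le> pi - ?y" using p by (simp add: field_simps)
  qed
  have sinx: "sin ?y \<le> sin ?x"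
  proof (cases "?x \<le> pi / 2")
    case True
    then show ?thesis using xy y y' by (intro sin_monotone_2pi_le) auto
  next
    case False
    then have "sin ?y \<le> sin (pi - ?x)" using xy y y' by (intro sin_monotone_2pi_le) auto
    then show ?thesis by simp
  qed
  have siny: "sin ?y \<ge> real w / real p"
  proof -
    have "real w / real p = 2 * real w / real p / 2" by simp
    also have "\<dots> \<le> ?y / 2"
      using pi_ge_two by (intro divide_right_mono mult_right_mono) auto
    also have "\<dots> \<le> sin ?y" using sin_ge_half y by blast
    finally show ?thesis .
  qed
  have normz: "norm (1 - unit_root p s) = 2 * \<bar>sin ?x\<bar>"
  proof -
    have arg: "2 * pi * real_of_int s / real p = 2 * ?x" by simp
    have "(norm (1 - unit_root p s))\<^sup>2 = (1 - cos (2 * ?x))\<^sup>2 + (sin (2 * ?x))\<^sup>2"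
      unfolding unit_root_def arg by (simp add: cmod_power2)
    also have "\<dots> = 2 - 2 * cos (2 * ?x)"
      using sin_cos_squared_add[of "2 * ?x"] by (simp add: power2_eq_square algebra_simps)
    also have "\<dots> = (2 * \<bar>sin ?x\<bar>)\<^sup>2" using cos_double_sin[of ?x] by (simp add: power_mult_distrib)
    finally show ?thesis by (rule power2_eq_imp_eq) auto
  qed
  then have lower: "norm (1 - unit_root p s) \<ge> 2 * (real w / real p)" using sinx siny by linarith
  have wp: "real w / real p > 0" using w p by simp
  have ne: "unit_root p s \<noteq> 1" using lower wp by auto
  have n1: "norm (unit_root p s) = 1" by (simp add: unit_root_def)
  have "(\<Sum>j=1..J. Re (unit_root p (int j * t))) = Re (\<Sum>j=1..J. unit_root p s ^ j)"
    by (simp add: unit_root_power et)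
  also have "\<dots> \<le> norm (\<Sum>j=1..J. unit_root p s ^ j)" by (rule complex_Re_le_cmod)
  also have "\<dots> \<le> 2 / norm (1 - unit_root p s)"
  proof (cases "J = 0")
    case False
    then have "(\<Sum>j=1..J. unit_root p s ^ j) = (unit_root p s ^ 1 - unit_root p s ^ Suc J) / (1 - unit_root p s)"
      using ne by (subst sum_gp) simp
    moreover have "norm (unit_root p s ^ 1 - unit_root p s ^ Suc J) \<le> 2"
      using norm_triangle_ineq4[of "unit_root p s ^ 1" "unit_root p s ^ Suc J"] n1 by (simp add: norm_mult norm_power)
    ultimately show ?thesis by (simp only: norm_divide) (rule divide_right_mono, auto)
  qed simp
  also have "\<dots> \<le> 2 / (2 * (real w / real p))"
    using lower wp by (intro divide_left_mono mult_pos_pos) linarith+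
  also have "\<dots> = real p / real w" by simp
  finally show ?thesis .
qed

section \<open>Growth from the Loomis-Whitney inequality\<close>

text \<open>
  A slice with fixed first coordinate has at most as many points as the projection to the last two
  coordinates, and at most as many as the product of its own two projections. Taking the geometric
  mean and summing with the Cauchy-Schwarz inequality gives the claim.
\<close>

lemma loomis_whitney:
  fixes Z :: "('a \<times> 'b \<times> 'c) set"
  assumes fin: "finite Z"
  shows "(card Z)\<^sup>2 \<le> card ((\<lambda>(x, y, z). (x, y)) ` Z) * card ((\<lambda>(x, y, z). (x, z)) ` Z)
     * card ((\<lambda>(x, y, z). (y, z)) ` Z)"
proof -
  define X where "X = fst ` Z"
  define A where "A = (\<lambda>x. fst ` (Z `` {x}))"
  define B where "B = (\<lambda>x. snd ` (Z `` {x}))"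
  define c where "c = real (card (snd ` Z))"
  have finX: "finite X" using fin by (simp add: X_def)
  have finZ: "finite (Z `` {x})" for x
    by (rule finite_subset[of _ "snd ` Z"]) (use fin in force)+
  have finAB: "finite (A x)" "finite (B x)" for x using finZ by (simp_all add: A_def B_def)
  have cardZ: "card Z = (\<Sum>x\<in>X. card (Z `` {x}))"
  proof -
    have "Z = (SIGMA x:X. Z `` {x})" by (force simp: X_def)
    then have "card Z = card (SIGMA x:X. Z `` {x})" by (rule arg_cong)
    also have "\<dots> = (\<Sum>x\<in>X. card (Z `` {x}))" using finX finZ by simp
    finally show ?thesis .
  qed
  have cardA: "card ((\<lambda>(x, y, z). (x, y)) ` Z) = (\<Sum>x\<in>X. card (A x))"
  proof -
    have "(\<lambda>(x, y, z). (x, y)) ` Z = Sigma X A" by (force simp: X_def A_def)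
    then show ?thesis using finX finAB by simp
  qed
  have cardB: "card ((\<lambda>(x, y, z). (x, z)) ` Z) = (\<Sum>x\<in>X. card (B x))"
  proof -
    have "(\<lambda>(x, y, z). (x, z)) ` Z = Sigma X B" by (force simp: X_def B_def)
    then show ?thesis using finX finAB by simp
  qed
  have cardC: "(\<lambda>(x, y, z). (y, z)) ` Z = snd ` Z" by force
  have slice: "real (card (Z `` {x})) \<le> sqrt c * (sqrt (real (card (A x))) * sqrt (real (card (B x))))" for x
  proof -
    have 1: "real (card (Z `` {x})) \<le> c"
      unfolding c_def using fin by (intro of_nat_mono card_mono) force+
    have "Z `` {x} \<subseteq> A x \<times> B x" by (force simp: A_def B_def)
    then have "card (Z `` {x}) \<le> card (A x) * card (B x)"
      using card_mono[of "A x \<times> B x"] finAB by (simp add: card_cartesian_product)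
    then have 2: "real (card (Z `` {x})) \<le> real (card (A x)) * real (card (B x))"
      by (metis of_nat_le_iff of_nat_mult)
    have "(real (card (Z `` {x})))\<^sup>2 \<le> c * (real (card (A x)) * real (card (B x)))"
      unfolding power2_eq_square using 1 2 by (intro mult_mono) (auto simp: c_def)
    then show ?thesis unfolding real_sqrt_mult[symmetric] by (rule real_le_rsqrt)
  qed
  have "real (card Z) \<le> sqrt c * (\<Sum>x\<in>X. sqrt (real (card (A x))) * sqrt (real (card (B x))))"
    unfolding cardZ sum_distrib_left of_nat_sum by (intro sum_mono slice)
  also have "(\<Sum>x\<in>X. sqrt (real (card (A x))) * sqrt (real (card (B x)))) \<le>
      sqrt (\<Sum>x\<in>X. real (card (A x))) * sqrt (\<Sum>x\<in>X. real (card (B x)))"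
    using L2_set_mult_ineq[of "\<lambda>x. sqrt (real (card (A x)))" "\<lambda>x. sqrt (real (card (B x)))" X]
    by (simp add: L2_set_def)
  finally have "real (card Z) \<le> sqrt (c * ((\<Sum>x\<in>X. real (card (A x))) * (\<Sum>x\<in>X. real (card (B x)))))"
    by (simp add: real_sqrt_mult mult_left_mono c_def)
  then have "(real (card Z))\<^sup>2 \<le> c * ((\<Sum>x\<in>X. real (card (A x))) * (\<Sum>x\<in>X. real (card (B x))))"
    by (intro sqrt_ge_absD) simp
  also have "\<dots> = real (card ((\<lambda>(x, y, z). (x, y)) ` Z) * card ((\<lambda>(x, y, z). (x, z)) ` Z)
     * card ((\<lambda>(x, y, z). (y, z)) ` Z))"
    unfolding cardA cardB cardC c_def by simp
  finally show ?thesis by (metis of_nat_le_iff of_nat_power)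
qed

lemma cong_zero_multiple:
  assumes "prime p" "cong_zero p (multiple j b)" "\<not> int p dvd int j"
  shows "cong_zero p b"
  using assms by (cases b) (auto simp: prime_dvd_mult_eq_int)

lemma multiple_diff: "j \<le> k \<Longrightarrow> multiple k b - multiple j b = multiple (k - j) b"
  by (cases b) (simp add: of_nat_diff algebra_simps)

text \<open>
  A map \<open>c\<close> that is constant on lines in direction \<open>b\<close> groups the points of \<open>Y\<close>. A
  class which no point leaves under translation by \<open>b\<close> contains a full line of \<open>p\<close> points; every
  other class contributes to the growth.
\<close>

lemma lines_le_growth:
  assumes p: "prime p" and Y: "periodic p Y" and b: "\<not> cong_zero p b"
    and c: "\<And>v. c (v + b) = c v" "\<And>v u. cong_zero p u \<Longrightarrow> c (v + u) = c v"
  shows "p * card (c ` (Y \<inter> residue_box p)) \<le> p * growth p Y b + size_mod p Y"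
proof -
  let ?B = "Y \<inter> residue_box p"
  let ?h = "\<lambda>v. p * of_bool (v + b \<notin> Y) + 1"
  have p0: "p > 0" using p prime_gt_0_nat by blast
  have fibre: "p \<le> (\<Sum>v\<in>{v\<in>?B. c v = \<kappa>}. ?h v)" if \<kappa>: "\<kappa> \<in> c ` ?B" for \<kappa>
  proof (cases "\<exists>v\<in>{v\<in>?B. c v = \<kappa>}. v + b \<notin> Y")
    case True
    then obtain v where v: "v \<in> {v\<in>?B. c v = \<kappa>}" "v + b \<notin> Y" by blast
    have "p \<le> ?h v" using v by simp
    also have "\<dots> \<le> (\<Sum>v\<in>{v\<in>?B. c v = \<kappa>}. ?h v)" using v by (intro member_le_sum) auto
    finally show ?thesis .
  next
    case False
    obtain v where v: "v \<in> ?B" "c v = \<kappa>" using \<kappa> by blast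
    have red: "c (reduce p u) = c u" for u
      using c(2)[of "u - reduce p u" "reduce p u"] cong_zero_reduce[of p u] by simp
    have step: "u + b \<in> Y" if "u \<in> Y" "c u = \<kappa>" for u
    proof -
      have "reduce p u \<in> ?B" using periodicD[OF Y cong_zero_reduce] that reduce_in_residue_box[OF p0] by blast
      then have "reduce p u + b \<in> Y" using False red that by blast
      moreover have "cong_zero p ((u + b) - (reduce p u + b))" using cong_zero_reduce by simp
      ultimately show ?thesis using periodicD[OF Y] by blast
    qed
    \<comment> \<open>no point of the class leaves \<open>Y\<close>, so the whole line through \<open>v\<close> lies in \<open>Y\<close>\<close>
    have orbit: "v + multiple j b \<in> Y \<and> c (v + multiple j b) = \<kappa>" for j
    proof (induction j)
      case 0
      have "multiple 0 b = 0" by (cases b) (simp add: zero_prod_def)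
      then show ?case using v by simp
    next
      case (Suc j)
      have "v + multiple (Suc j) b = v + multiple j b + b" by (cases b; cases v) (simp add: algebra_simps)
      then show ?case using step Suc c(1) by metis
    qed
    have inj: "inj_on (\<lambda>j. reduce p (v + multiple j b)) {..<p}"
    proof (rule linorder_inj_onI)
      fix j k assume jk: "j < k" "j \<in> {..<p}" "k \<in> {..<p}"
      show "reduce p (v + multiple j b) \<noteq> reduce p (v + multiple k b)"
      proof
        assume eq: "reduce p (v + multiple j b) = reduce p (v + multiple k b)"
        have "cong_zero p (v + multiple k b - reduce p (v + multiple k b))" "cong_zero p (reduce p (v + multiple j b) - (v + multiple j b))"
          using cong_zero_reduce cong_zero_minus by blast+
        then have "cong_zero p (multiple k b - multiple j b)"
          using cong_zero_add[of p "v + multiple k b - reduce p (v + multiple k b)" "reduce p (v + multiple j b) - (v + multiple j b)"]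
          unfolding eq by simp
        then have "cong_zero p (multiple (k - j) b)" using jk by (simp add: multiple_diff)
        moreover have "\<not> int p dvd int (k - j)"
          using jk by (simp add: nat_dvd_not_less del: of_nat_diff)
        ultimately show False using cong_zero_multiple[OF p] b by blast
      qed
    qed auto
    have "(\<lambda>j. reduce p (v + multiple j b)) ` {..<p} \<subseteq> {v\<in>?B. c v = \<kappa>}"
    proof (rule image_subsetI)
      fix j assume "j \<in> {..<p}"
      show "reduce p (v + multiple j b) \<in> {v\<in>?B. c v = \<kappa>}"
        using orbit[of j] red reduce_in_residue_box[OF p0]
          periodicD[OF Y cong_zero_reduce, of "v + multiple j b"] by simp
    qed
    then have "card {..<p} \<le> card {v\<in>?B. c v = \<kappa>}"
      using inj by (intro card_inj_on_le) auto
    also have "\<dots> = (\<Sum>v\<in>{v\<in>?B. c v = \<kappa>}. 1)" by simp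
    also have "\<dots> \<le> (\<Sum>v\<in>{v\<in>?B. c v = \<kappa>}. ?h v)" by (intro sum_mono) simp
    finally show ?thesis by simp
  qed
  have "p * card (c ` ?B) = (\<Sum>\<kappa>\<in>c ` ?B. p)" by simp
  also have "\<dots> \<le> (\<Sum>\<kappa>\<in>c ` ?B. \<Sum>v\<in>{v\<in>?B. c v = \<kappa>}. ?h v)" by (rule sum_mono[OF fibre])
  also have "\<dots> = (\<Sum>v\<in>?B. ?h v)" by (rule sum.image_gen[symmetric]) simp
  also have "\<dots> = p * (\<Sum>v\<in>?B. of_bool (v + b \<notin> Y)) + card ?B"
    by (simp only: sum.distrib sum_distrib_left card_eq_sum)
  also have "(\<Sum>v\<in>?B. of_bool (v + b \<notin> Y)) = growth p Y b"
  proof -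
    have "?B \<inter> {v. v + b \<notin> Y} = {v \<in> residue_box p. v \<in> Y \<and> v + b \<notin> Y}" by auto
    then show ?thesis by (simp add: growth_def)
  qed
  finally show ?thesis by (simp add: size_mod_def)
qed

fun cross :: "int3 \<Rightarrow> int3 \<Rightarrow> int3" where
  "cross (x1, x2, x3) (y1, y2, y3) = (x2 * y3 - x3 * y2, x3 * y1 - x1 * y3, x1 * y2 - x2 * y1)"

lemma dot_cross_self: "dot (cross a b) a = 0" "dot (cross a b) b = 0"
  by (cases a; cases b; simp add: algebra_simps)+

lemma dot_cross_rotate: "dot (cross b c) a = dot (cross a b) c" "dot (cross c a) b = dot (cross a b) c"
  by (cases a; cases b; cases c; simp add: algebra_simps)+

text \<open>
  Cramer's rule: \<open>dot (cross a b) c\<close> times \<open>v\<close> is the combination of \<open>a\<close>, \<open>b\<close>, \<open>c\<close> whose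
  coefficients are the three other products.
\<close>

lemma cong_zero_if_dot_cross:
  assumes p: "prime p" and det: "\<not> int p dvd dot (cross a b) c"
    and "int p dvd dot (cross b c) v" "int p dvd dot (cross c a) v" "int p dvd dot (cross a b) v"
  shows "cong_zero p v"
proof -
  obtain a1 a2 a3 b1 b2 b3 c1 c2 c3 v1 v2 v3 where
    e: "a = (a1, a2, a3)" "b = (b1, b2, b3)" "c = (c1, c2, c3)" "v = (v1, v2, v3)"
    by (cases a; cases b; cases c; cases v) blast
  have "dot (cross a b) c * v1 = dot (cross b c) v * a1 + dot (cross c a) v * b1 + dot (cross a b) v * c1"
    "dot (cross a b) c * v2 = dot (cross b c) v * a2 + dot (cross c a) v * b2 + dot (cross a b) v * c2"
    "dot (cross a b) c * v3 = dot (cross b c) v * a3 + dot (cross c a) v * b3 + dot (cross a b) v * c3"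
    unfolding e by (simp_all add: algebra_simps)
  then have "int p dvd dot (cross a b) c * v1" "int p dvd dot (cross a b) c * v2" "int p dvd dot (cross a b) c * v3"
    using assms(3-5) by (metis dvd_add dvd_mult2)+
  then show ?thesis using p det unfolding e(4) cong_zero.simps by (meson prime_dvd_mult_eq_int prime_int_nat_transfer prime_nat_int_transfer)
qed

text \<open>
  In the coordinates dual to the basis, the three coordinate projections of \<open>Y\<close> are its images in
  the spaces of lines in the three basis directions. By Loomis-Whitney one of these
  images has size \<open>L\<close> with \<open>|Y|\<^sup>2 \<le> L\<^sup>3\<close>, and at most half of its lines are full as \<open>2|Y| \<le> L p\<close>.
\<close>

lemma exists_growth_of_basis:
  assumes p: "prime p" and Y: "periodic p Y" "8 * size_mod p Y \<le> p ^ 3"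
    and det: "\<not> int p dvd dot (cross b1 b2) b3"
  shows "\<exists>b\<in>{b1, b2, b3}. (size_mod p Y)\<^sup>2 \<le> (2 * growth p Y b) ^ 3"
proof -
  let ?B = "Y \<inter> residue_box p"
  define m where "m = (\<lambda>k v. dot k v mod int p)"
  define k1 k2 k3 where "k1 = cross b2 b3" and "k2 = cross b3 b1" and "k3 = cross b1 b2"
  have p0: "p > 0" using p prime_gt_0_nat by blast
  have m_cong_zero: "m k (v + u) = m k v" if "cong_zero p u" for k v u
    using cong_zero_dot[OF that] by (auto simp: m_def dot_add mod_eq_dvd_iff)
  have m_orth: "m k (v + b) = m k v" if "dot k b = 0" for k v b
    using that by (simp add: m_def dot_add)
  have basis: "\<not> cong_zero p b1" "\<not> cong_zero p b2" "\<not> cong_zero p b3"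
    using det cong_zero_dot dot_cross_rotate by metis+
  define Z where "Z = (\<lambda>v. (m k1 v, m k2 v, m k3 v)) ` ?B"
  have "inj_on (\<lambda>v. (m k1 v, m k2 v, m k3 v)) ?B"
  proof (rule inj_onI)
    fix v w assume vw: "v \<in> ?B" "w \<in> ?B" "(m k1 v, m k2 v, m k3 v) = (m k1 w, m k2 w, m k3 w)"
    then have "int p dvd dot k1 (v - w)" "int p dvd dot k2 (v - w)" "int p dvd dot k3 (v - w)"
      by (auto simp: m_def dot_diff mod_eq_dvd_iff)
    then have "cong_zero p (v - w)" using cong_zero_if_dot_cross[OF p det] unfolding k1_def k2_def k3_def by blast
    then show "v = w" using vw residue_box_eqI by blast
  qed
  then have cardZ: "card Z = size_mod p Y" by (simp add: Z_def size_mod_def card_image)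
  define l1 where "l1 = card ((\<lambda>v. (m k2 v, m k3 v)) ` ?B)"
  define l2 where "l2 = card ((\<lambda>v. (m k1 v, m k3 v)) ` ?B)"
  define l3 where "l3 = card ((\<lambda>v. (m k1 v, m k2 v)) ` ?B)"
  have "finite Z" by (simp add: Z_def)
  from loomis_whitney[OF this] have LW: "(size_mod p Y)\<^sup>2 \<le> l3 * l2 * l1"
    unfolding cardZ by (simp add: Z_def image_image l1_def l2_def l3_def)
  have g1: "p * l1 \<le> p * growth p Y b1 + size_mod p Y"
    unfolding l1_def
    by (rule lines_le_growth[OF p Y(1) basis(1)]) (simp_all add: m_cong_zero m_orth k2_def k3_def dot_cross_self)
  have g2: "p * l2 \<le> p * growth p Y b2 + size_mod p Y"
    unfolding l2_def
    by (rule lines_le_growth[OF p Y(1) basis(2)]) (simp_all add: m_cong_zero m_orth k1_def k3_def dot_cross_self)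
  have g3: "p * l3 \<le> p * growth p Y b3 + size_mod p Y"
    unfolding l3_def
    by (rule lines_le_growth[OF p Y(1) basis(3)]) (simp_all add: m_cong_zero m_orth k1_def k2_def dot_cross_self)
  define L where "L = Max {l1, l2, l3}"
  have L: "l1 \<le> L" "l2 \<le> L" "l3 \<le> L" "L \<in> {l1, l2, l3}" by (auto simp: L_def max_def)
  have yL: "(size_mod p Y)\<^sup>2 \<le> L ^ 3"
  proof -
    have "l3 * l2 * l1 \<le> L * L * L" using L by (intro mult_mono) auto
    then show ?thesis using LW by (simp add: power3_eq_cube)
  qed
  have "(2 * size_mod p Y) ^ 3 \<le> (L * p) ^ 3"
  proof -
    have "(2 * size_mod p Y) ^ 3 = (size_mod p Y)\<^sup>2 * (8 * size_mod p Y)"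
      by (simp add: power3_eq_cube power2_eq_square)
    also have "\<dots> \<le> L ^ 3 * p ^ 3" using yL Y(2) by (rule mult_mono) auto
    finally show ?thesis by (simp add: power_mult_distrib)
  qed
  then have half: "2 * size_mod p Y \<le> L * p"
    using power_mono_iff[of "2 * size_mod p Y" "L * p" 3] by simp
  obtain b where b: "b \<in> {b1, b2, b3}" "p * L \<le> p * growth p Y b + size_mod p Y"
    using L(4) g1 g2 g3 by (metis insertCI insertE singletonD)
  have "p * L \<le> p * (2 * growth p Y b)"
  proof -
    have "2 * (p * L) \<le> 2 * (p * growth p Y b) + p * L"
      using b(2) half by (simp only: mult.commute[of L p])
    then show ?thesis by (simp only: mult.left_commute[of p 2])
  qed
  then have "L \<le> 2 * growth p Y b" using p0 by simp
  then have "L ^ 3 \<le> (2 * growth p Y b) ^ 3" by (rule power_mono) simp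
  then show ?thesis using b(1) yL le_trans by blast
qed

text \<open>
  If no plane through the origin contains all vectors, three of them are independent.
\<close>

lemma exists_growth_of_spread:
  assumes p: "prime p" and Y: "periodic p Y" "8 * size_mod p Y \<le> p ^ 3"
    and spread: "\<And>k. \<not> cong_zero p k \<Longrightarrow> \<exists>i\<in>I. \<not> int p dvd dot k (a i)"
  shows "\<exists>i\<in>I. (size_mod p Y)\<^sup>2 \<le> (2 * growth p Y (a i)) ^ 3"
proof -
  have p1: "\<not> int p dvd 1" using p by auto
  obtain i1 where i1: "i1 \<in> I" "\<not> int p dvd dot (1, 0, 0) (a i1)"
    using spread[of "(1, 0, 0)"] p1 by auto
  obtain x y z where a1: "a i1 = (x, y, z)" by (cases "a i1")
  have x: "\<not> int p dvd x" using i1 a1 by simp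
  \<comment> \<open>this product is the last coordinate of \<open>cross (a i1) (a i2)\<close>\<close>
  obtain i2 where i2: "i2 \<in> I" "\<not> int p dvd dot (- y, x, 0) (a i2)"
    using spread[of "(- y, x, 0)"] x by auto
  have "\<not> cong_zero p (cross (a i1) (a i2))"
    using i2(2) unfolding a1 by (cases "a i2") (simp add: algebra_simps)
  then obtain i3 where "i3 \<in> I" "\<not> int p dvd dot (cross (a i1) (a i2)) (a i3)"
    using spread by blast
  then show ?thesis
    using exists_growth_of_basis[OF p Y, of "a i1" "a i2" "a i3"] i1 i2 by auto
qed

section \<open>Large sets of subset sums\<close>

definition subset_sums :: "nat \<Rightarrow> (nat \<Rightarrow> int3) \<Rightarrow> nat set \<Rightarrow> int3 set" where
  "subset_sums p a B = {v. \<exists>X\<subseteq>B. cong_zero p (v - sum a X)}"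

lemma periodic_subset_sums: "periodic p (subset_sums p a B)"
proof -
  have imp: "v + u \<in> subset_sums p a B" if u: "cong_zero p u" and v: "v \<in> subset_sums p a B" for v u
  proof -
    obtain X where "X \<subseteq> B" "cong_zero p (v - sum a X)" using v unfolding subset_sums_def by blast
    then have "cong_zero p (u + (v - sum a X))" using u cong_zero_add by blast
    then have "cong_zero p (v + u - sum a X)" by (simp add: algebra_simps)
    then show ?thesis using \<open>X \<subseteq> B\<close> unfolding subset_sums_def by blast
  qed
  have "v \<in> subset_sums p a B" if u: "cong_zero p u" "v + u \<in> subset_sums p a B" for v u
  proof -
    have "cong_zero p (- u)" using cong_zero_minus[of p u 0] u by simp
    then show ?thesis using imp[OF _ u(2)] by fastforce
  qed
  then show ?thesis using imp unfolding periodic_def by blast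
qed

text \<open>
  The new index contributes the translate by \<open>a i\<close> of the former subset sums.
\<close>

lemma size_subset_sums_insert:
  assumes p: "p > 0" and B: "finite B" "i \<notin> B"
  shows "size_mod p (subset_sums p a B) + growth p (subset_sums p a B) (a i)
     \<le> size_mod p (subset_sums p a (insert i B))"
proof -
  let ?Y = "subset_sums p a B" and ?Z = "subset_sums p a (insert i B)"
  let ?f = "\<lambda>v. reduce p (v + a i)"
  define G where "G = {v \<in> residue_box p. v \<in> ?Y \<and> v + a i \<notin> ?Y}"
  have inj: "inj_on ?f G"
    using bij_betw_shift_residue_box[OF p, of "a i"] by (auto simp: bij_betw_def G_def intro: inj_on_subset)
  have sub: "?Y \<subseteq> ?Z" by (auto simp: subset_sums_def)
  have "?f v \<in> ?Z \<inter> residue_box p - ?Y" if v: "v \<in> G" for v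
  proof -
    obtain X where X: "X \<subseteq> B" "cong_zero p (v - sum a X)" using v unfolding G_def subset_sums_def by blast
    have "sum a (insert i X) = a i + sum a X"
      using X B by (intro sum.insert) (auto intro: finite_subset)
    then have "cong_zero p (v + a i - sum a (insert i X))" using X by (simp add: algebra_simps)
    moreover have "insert i X \<subseteq> insert i B" using X by blast
    ultimately have "v + a i \<in> ?Z" unfolding subset_sums_def by blast
    then have "?f v \<in> ?Z" using periodicD[OF periodic_subset_sums cong_zero_reduce] by blast
    moreover have "?f v \<notin> ?Y" using v periodicD[OF periodic_subset_sums cong_zero_reduce] unfolding G_def by blast
    ultimately show ?thesis using reduce_in_residue_box p by blast
  qed
  then have "(?Y \<inter> residue_box p) \<union> ?f ` G \<subseteq> ?Z \<inter> residue_box p" "(?Y \<inter> residue_box p) \<inter> ?f ` G = {}"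
    using sub by blast+
  then have "card (?Y \<inter> residue_box p) + card (?f ` G) \<le> card (?Z \<inter> residue_box p)"
    using card_mono[of "?Z \<inter> residue_box p" "(?Y \<inter> residue_box p) \<union> ?f ` G"]
    by (subst card_Un_disjoint[symmetric]) (auto simp: G_def)
  then show ?thesis using inj by (simp add: card_image size_mod_def growth_def G_def)
qed

lemma size_subset_sums_empty:
  assumes "p > 0"
  shows "size_mod p (subset_sums p a {}) \<ge> 1"
proof -
  have "0 \<in> subset_sums p a {} \<inter> residue_box p" using assms by (auto simp: subset_sums_def residue_box_def zero_prod_def)
  then show ?thesis unfolding size_mod_def by (metis One_nat_def Suc_leI card_gt_0_iff empty_iff finite_Int finite_residue_box)
qed

text \<open>
  The case in which no affine plane modulo \<open>p\<close> is rich enough to contain a zero sum by itself, so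
  that the family has to be used as a whole.
\<close>

locale thinly_spread =
  fixes p :: nat and a :: "nat \<Rightarrow> int3" and I :: "nat set"
  assumes prime: "prime p" and large: "p \<ge> 5000" and fin: "finite I"
    and many: "card I \<ge> 20369 * (p - 1) + 1"
    and plane: "\<And>k t. \<not> cong_zero p k \<Longrightarrow> card {i \<in> I. int p dvd dot k (a i) - t} \<le> 4 * p - 3"
begin

lemma p_pos: "p > 0" using large by simp

lemma card_remaining:
  assumes "B \<subseteq> I" "card B < p"
  shows "card (I - B) \<ge> 20368 * (p - 1) + 1"
proof -
  have "card (I - B) = card I - card B" using assms fin by (meson card_Diff_subset finite_subset)
  then show ?thesis using assms many by simp
qed

text \<open>
  The indices outside \<open>B\<close> are more numerous than those in any single plane.
\<close>

lemma isoperimetric_step: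
  assumes B: "B \<subseteq> I" "card B < p" and Y: "periodic p Y" "8 * size_mod p Y \<le> p ^ 3"
  shows "\<exists>i\<in>I - B. (size_mod p Y)\<^sup>2 \<le> (2 * growth p Y (a i)) ^ 3"
proof (rule exists_growth_of_spread[OF prime Y])
  fix k assume k: "\<not> cong_zero p k"
  show "\<exists>i\<in>I - B. \<not> int p dvd dot k (a i)"
  proof (rule ccontr)
    assume "\<not> ?thesis"
    then have "card (I - B) \<le> card {i \<in> I. int p dvd dot k (a i) - 0}"
      using fin by (intro card_mono) auto
    then show False using card_remaining[OF B] plane[OF k, of 0] large by linarith
  qed
qed

text \<open>
  For a given character, the indices whose product with \<open>k\<close> lies within distance 1199 of 0 modulo
  \<open>p\<close> belong to 2399 planes. These contain at most \<open>2399(4p - 3)\<close> indices, which is less than half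
  of the \<open>20368(p - 1) + 1\<close> indices outside \<open>B\<close>.
\<close>

lemma fourier_step:
  assumes B: "B \<subseteq> I" "card B < p" and Y: "periodic p Y" "2 * size_mod p Y \<le> p ^ 3"
  shows "\<exists>i\<in>I - B. 100 * size_mod p Y \<le> p * growth p Y (a i)"
proof -
  \<comment> \<open>large enough that \<open>p / 1200 \<le> J / 2\<close>, small enough that \<open>400(J + 1) \<le> p\<close>\<close>
  define J where "J = p div 500"
  let ?R = "I - B"
  have R: "finite ?R" using fin by blast
  have R0: "?R \<noteq> {}" using card_remaining[OF B] by (metis card.empty not_one_le_zero add_leE)
  have J: "J \<ge> 1" "600 * J \<ge> p" "100 * (4 * (J + 1)) \<le> p"
  proof -
    have J500: "J * 500 \<le> p" "p < 500 + J * 500"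
      using div_times_less_eq_dividend[of p 500] dividend_less_div_times[of 500 p]
      unfolding J_def by simp_all
    then show "J \<ge> 1" "600 * J \<ge> p" "100 * (4 * (J + 1)) \<le> p" using large by simp_all
  qed
  have far: "card ?R \<le> 2 * card {i \<in> ?R. (\<Sum>j=1..J. Re (unit_root p (int j * dot k (a i)))) \<le> J / 2}"
    if k: "k \<in> residue_box p" "k \<noteq> 0" for k
  proof -
    let ?G = "{i \<in> ?R. (\<Sum>j=1..J. Re (unit_root p (int j * dot k (a i)))) \<le> J / 2}"
    let ?T = "{-1199..1199::int}"
    have "\<not> cong_zero p k"
      using residue_box_eqI[of k p 0] k p_pos by (auto simp: residue_box_def zero_prod_def)
    then have pl: "card {i \<in> I. int p dvd dot k (a i) - t} \<le> 4 * p - 3" for t by (rule plane)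
    have "?R - ?G \<subseteq> (\<Union>t\<in>?T. {i \<in> I. int p dvd dot k (a i) - t})"
    proof
      fix i assume i: "i \<in> ?R - ?G"
      let ?s = "dot k (a i)"
      have "\<not> (int 1200 \<le> ?s mod int p \<and> ?s mod int p \<le> int p - int 1200)"
      proof
        assume mid: "int 1200 \<le> ?s mod int p \<and> ?s mod int p \<le> int p - int 1200"
        have "(\<Sum>j=1..J. Re (unit_root p (int j * ?s))) \<le> real p / real 1200"
          by (rule cos_sum_bound) (use mid large in auto)
        also have "\<dots> \<le> J / 2" using J(2) by simp
        finally show False using i by blast
      qed
      then consider "?s mod int p \<in> ?T" | "?s mod int p - int p \<in> ?T"
      proof -
        have "0 \<le> ?s mod int p" "?s mod int p < int p" using p_pos by simp_all
        then have "?s mod int p \<in> ?T \<or> ?s mod int p - int p \<in> ?T"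
          using \<open>\<not> (int 1200 \<le> ?s mod int p \<and> ?s mod int p \<le> int p - int 1200)\<close>
          unfolding atLeastAtMost_iff by linarith
        then show ?thesis using that by blast
      qed
      then obtain t where "t \<in> ?T" "int p dvd ?s - t"
      proof cases
        case 1
        then show ?thesis using that[of "?s mod int p"] by (simp add: minus_mod_eq_mult_div)
      next
        case 2
        have "?s - (?s mod int p - int p) = int p * (?s div int p + 1)"
          by (simp add: minus_mod_eq_mult_div[symmetric] algebra_simps)
        then show ?thesis using that[of "?s mod int p - int p"] 2 by simp
      qed
      then show "i \<in> (\<Union>t\<in>?T. {i \<in> I. int p dvd dot k (a i) - t})" using i by blast
    qed
    then have "card (?R - ?G) \<le> card (\<Union>t\<in>?T. {i \<in> I. int p dvd dot k (a i) - t})"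
      using fin by (intro card_mono) auto
    also have "\<dots> \<le> (\<Sum>t\<in>?T. card {i \<in> I. int p dvd dot k (a i) - t})" by (rule card_UN_le) simp
    also have "\<dots> \<le> (\<Sum>t\<in>?T. 4 * p - 3)" by (intro sum_mono pl)
    also have "\<dots> = 2399 * (4 * p - 3)" by simp
    finally have near: "card (?R - ?G) \<le> 2399 * (4 * p - 3)" .
    have "card ?R = card (?R - ?G) + card ?G"
      using card_Int_Diff[OF R, of ?G] by (simp add: Int_absorb1 subset_eq)
    then show ?thesis using near card_remaining[OF B] large by linarith
  qed
  obtain i where i: "i \<in> ?R" "size_mod p Y \<le> 4 * (J + 1) * growth p Y (a i)"
    using exists_growth_of_equidistribution[OF p_pos Y R R0 far J(1)] by blast
  have "100 * size_mod p Y \<le> 100 * (4 * (J + 1)) * growth p Y (a i)"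
    using mult_le_mono2[OF i(2), of 100] by (simp only: mult.assoc)
  also have "\<dots> \<le> p * growth p Y (a i)" using J(3) by (intro mult_right_mono) auto
  finally show ?thesis using i(1) by blast
qed

text \<open>
  The family is chosen disjoint from a set \<open>U\<close> of indices already in use. If
  \<open>|Y| \<ge> m\<^sup>3\<close> then the next step adds at least \<open>m\<^sup>2/2\<close>, and \<open>m\<^sup>3 + m\<^sup>2/2 \<ge> (m + 1/7)\<^sup>3\<close>
  for \<open>m \<ge> 1\<close>.
\<close>

lemma cubic_phase:
  assumes U: "U \<subseteq> I" "card U + k < p"
  shows "\<exists>D\<subseteq>I - U. card D \<le> k \<and>
     ((1 + real k / 7) ^ 3 \<le> size_mod p (subset_sums p a D) \<or> (real p / 35) ^ 3 \<le> size_mod p (subset_sums p a D))"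
  using U(2)
proof (induction k)
  case 0
  show ?case
    using size_subset_sums_empty[OF p_pos, of a] by (intro exI[of _ "{}"]) simp
next
  case (Suc k)
  then obtain D where D: "D \<subseteq> I - U" "card D \<le> k"
     "(1 + real k / 7) ^ 3 \<le> size_mod p (subset_sums p a D) \<or> (real p / 35) ^ 3 \<le> size_mod p (subset_sums p a D)"
    by auto
  let ?Y = "subset_sums p a D"
  show ?case
  proof (cases "(real p / 35) ^ 3 \<le> size_mod p ?Y")
    case True
    then show ?thesis using D by (intro exI[of _ D]) auto
  next
    case False
    \<comment> \<open>the next step has to raise this lower bound for the cube root of the size by \<open>1/7\<close>\<close>
    define m where "m = 1 + real k / 7"
    have m: "m \<ge> 1" "m ^ 3 \<le> size_mod p ?Y" using False D(3) by (auto simp: m_def)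
    have finD: "finite D" using D(1) fin by (auto intro: finite_subset)
    have "8 * real (size_mod p ?Y) \<le> real p ^ 3"
      using False by (simp add: power_divide field_simps)
    then have small: "8 * size_mod p ?Y \<le> p ^ 3"
      by (metis of_nat_le_iff of_nat_mult of_nat_numeral of_nat_power)
    have "card (U \<union> D) < p" using card_Un_le[of U D] D(2) Suc.prems by linarith
    then obtain i where i: "i \<in> I - (U \<union> D)" "(size_mod p ?Y)\<^sup>2 \<le> (2 * growth p ?Y (a i)) ^ 3"
      using isoperimetric_step[of "U \<union> D" ?Y] U(1) D(1) periodic_subset_sums small by auto
    let ?g = "real (growth p ?Y (a i))"
    have "(m\<^sup>2) ^ 3 = (m ^ 3)\<^sup>2" by (simp flip: power_mult)
    also have "\<dots> \<le> (real (size_mod p ?Y))\<^sup>2" using m by (intro power_mono) auto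
    also have "\<dots> \<le> (2 * ?g) ^ 3"
    proof -
      have "real ((size_mod p ?Y)\<^sup>2) \<le> real ((2 * growth p ?Y (a i)) ^ 3)" using i(2) by (simp only: of_nat_le_iff)
      then show ?thesis by simp
    qed
    finally have g: "m\<^sup>2 \<le> 2 * ?g" using power_mono_iff[of "m\<^sup>2" "2 * ?g" 3] by simp
    have "(m + 1 / 7) ^ 3 = m ^ 3 + (3 / 7) * m\<^sup>2 + (3 / 49) * m + 1 / 343"
      by (simp add: power3_eq_cube power2_eq_square field_simps)
    also have "\<dots> \<le> m ^ 3 + m\<^sup>2 / 2"
    proof -
      have "m \<le> m\<^sup>2" "1 \<le> m\<^sup>2" using m(1) by (simp_all add: self_le_power one_le_power)
      then show ?thesis by linarith
    qed
    also have "\<dots> \<le> real (size_mod p ?Y) + ?g" using m(2) g by linarith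
    also have "\<dots> \<le> real (size_mod p (subset_sums p a (insert i D)))"
      using size_subset_sums_insert[OF p_pos finD, of i a] i(1) by (simp flip: of_nat_add)
    finally have "(1 + real (Suc k) / 7) ^ 3 \<le> real (size_mod p (subset_sums p a (insert i D)))"
      by (simp add: m_def add_divide_distrib algebra_simps)
    moreover have "insert i D \<subseteq> I - U" "card (insert i D) \<le> Suc k"
      using i(1) D(1,2) card_insert_le_m1[of "Suc k" D i] by auto
    ultimately show ?thesis by blast
  qed
qed

lemma exponential_phase:
  assumes U: "U \<subseteq> I" "card U + m + k < p"
    and D0: "D0 \<subseteq> I - U" "card D0 \<le> m" "(real p / 35) ^ 3 \<le> size_mod p (subset_sums p a D0)"
  shows "\<exists>D\<subseteq>I - U. card D \<le> m + k \<and>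
     ((1 + 100 / real p) ^ k * (real p / 35) ^ 3 \<le> size_mod p (subset_sums p a D) \<or>
       p ^ 3 < 2 * size_mod p (subset_sums p a D))"
  using U(2)
proof (induction k)
  case 0
  show ?case using D0 by (intro exI[of _ D0]) simp
next
  case (Suc k)
  then obtain D where D: "D \<subseteq> I - U" "card D \<le> m + k"
     "(1 + 100 / real p) ^ k * (real p / 35) ^ 3 \<le> size_mod p (subset_sums p a D) \<or>
       p ^ 3 < 2 * size_mod p (subset_sums p a D)"
    by auto
  let ?Y = "subset_sums p a D"
  show ?case
  proof (cases "p ^ 3 < 2 * size_mod p ?Y")
    case True
    then show ?thesis using D by (intro exI[of _ D]) auto
  next
    case False
    have finD: "finite D" using D(1) fin by (auto intro: finite_subset)
    have "card (U \<union> D) < p" using card_Un_le[of U D] D(2) Suc.prems by linarith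
    then obtain i where i: "i \<in> I - (U \<union> D)" "100 * size_mod p ?Y \<le> p * growth p ?Y (a i)"
      using fourier_step[of "U \<union> D" ?Y] U(1) D(1) periodic_subset_sums False by auto
    let ?g = "real (growth p ?Y (a i))"
    have "real (100 * size_mod p ?Y) \<le> real (p * growth p ?Y (a i))" using i(2) by (simp only: of_nat_le_iff)
    then have g: "100 / real p * real (size_mod p ?Y) \<le> ?g" using p_pos by (simp add: field_simps)
    have "(1 + 100 / real p) ^ Suc k * (real p / 35) ^ 3 =
       (1 + 100 / real p) * ((1 + 100 / real p) ^ k * (real p / 35) ^ 3)" by simp
    also have "\<dots> \<le> (1 + 100 / real p) * real (size_mod p ?Y)"
      using D(3) False by (intro mult_left_mono) auto
    also have "\<dots> \<le> real (size_mod p ?Y) + ?g" using g by (simp add: ring_distribs)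
    also have "\<dots> \<le> real (size_mod p (subset_sums p a (insert i D)))"
      using size_subset_sums_insert[OF p_pos finD, of i a] i(1) by (simp flip: of_nat_add)
    finally have "(1 + 100 / real p) ^ Suc k * (real p / 35) ^ 3 \<le> real (size_mod p (subset_sums p a (insert i D)))" .
    moreover have "insert i D \<subseteq> I - U" "card (insert i D) \<le> m + Suc k"
      using i(1) D(1,2) card_insert_le_m1[of "m + Suc k" D i] by auto
    ultimately show ?thesis by blast
  qed
qed

text \<open>
  After \<open>p/5\<close> steps the cubic phase has reached \<open>(p/35)\<^sup>3\<close>. A block of \<open>r\<close> steps of the
  exponential phase doubles the size, and 15 blocks suffice because \<open>2 ^ 15 > 35 ^ 3 / 2\<close>. All
  steps together fit into \<open>(p - 1)/2\<close> since \<open>p/5 + 15(p/100 + 1) \<le> (p - 1)/2\<close> for \<open>p \<ge> 5000\<close>.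
\<close>

lemma subset_sums_exceed_half:
  assumes U: "U \<subseteq> I" "card U \<le> (p - 1) div 2"
  shows "\<exists>D\<subseteq>I - U. card D \<le> (p - 1) div 2 \<and> p ^ 3 < 2 * size_mod p (subset_sums p a D)"
proof -
  \<comment> \<open>the least number of steps with \<open>100 r > p\<close>, so that \<open>(1 + 100/p) ^ r \<ge> 2\<close> by Bernoulli\<close>
  define r where "r = p div 100 + 1"
  have steps: "p div 5 + 15 * r \<le> (p - 1) div 2"
  proof -
    have "x + 15 * (y + 1) \<le> z" if "x * 5 \<le> p" "y * 100 \<le> p" "p - 1 < 2 + z * 2" for x y z
      using that large by simp
    then show ?thesis
      using div_times_less_eq_dividend dividend_less_div_times[of 2 "p - 1"] unfolding r_def by simp
  qed
  have half: "2 * ((p - 1) div 2) < p" using large by linarith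
  obtain D0 where D0: "D0 \<subseteq> I - U" "card D0 \<le> p div 5"
    "(1 + real (p div 5) / 7) ^ 3 \<le> size_mod p (subset_sums p a D0) \<or>
      (real p / 35) ^ 3 \<le> size_mod p (subset_sums p a D0)"
    using cubic_phase[OF U(1), of "p div 5"] U(2) half steps by auto
  have "real p / 35 \<le> 1 + real (p div 5) / 7"
  proof -
    have "p \<le> 5 + p div 5 * 5" using dividend_less_div_times[of 5 p] by simp
    then have "real p \<le> real (5 + p div 5 * 5)" by (simp only: of_nat_le_iff)
    then show ?thesis by simp
  qed
  then have "(real p / 35) ^ 3 \<le> (1 + real (p div 5) / 7) ^ 3" by (intro power_mono) auto
  then have big0: "(real p / 35) ^ 3 \<le> size_mod p (subset_sums p a D0)" using D0(3) by linarith
  have "card U + p div 5 + 15 * r < p" using U(2) half steps by linarith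
  then obtain D where D: "D \<subseteq> I - U" "card D \<le> p div 5 + 15 * r"
     "(1 + 100 / real p) ^ (15 * r) * (real p / 35) ^ 3 \<le> size_mod p (subset_sums p a D) \<or>
       p ^ 3 < 2 * size_mod p (subset_sums p a D)"
    using exponential_phase[OF U(1) _ D0(1,2) big0] by blast
  have "p ^ 3 < 2 * size_mod p (subset_sums p a D)"
  proof (rule ccontr)
    assume non: "\<not> ?thesis"
    have "p \<le> 100 * r"
      using dividend_less_div_times[of 100 p] unfolding r_def by simp
    then have "real p \<le> 100 * real r" by (metis of_nat_le_iff of_nat_mult of_nat_numeral)
    then have "2 \<le> 1 + real r * (100 / real p)" using p_pos by (simp add: field_simps)
    also have "\<dots> \<le> (1 + 100 / real p) ^ r"
      by (rule Bernoulli_inequality, rule order_trans[of _ 0]) simp_all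
    finally have "2 ^ 15 \<le> ((1 + 100 / real p) ^ r) ^ 15" by (rule power_mono) simp
    then have "32768 \<le> (1 + 100 / real p) ^ (15 * r)" by (simp add: mult.commute flip: power_mult)
    then have "32768 * (real p / 35) ^ 3 \<le> (1 + 100 / real p) ^ (15 * r) * (real p / 35) ^ 3"
      by (intro mult_right_mono) auto
    also have "\<dots> \<le> real (size_mod p (subset_sums p a D))" using D(3) non by auto
    finally have "32768 / 42875 * real p ^ 3 \<le> real (size_mod p (subset_sums p a D))"
      by (simp add: power_divide)
    moreover have "2 * real (size_mod p (subset_sums p a D)) \<le> real p ^ 3"
      using non by (metis not_le of_nat_le_iff of_nat_mult of_nat_numeral of_nat_power)
    moreover have "real p ^ 3 > 0" using p_pos by simp
    ultimately show False by linarith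
  qed
  then show ?thesis using D(1,2) steps by (intro exI[of _ D]) auto
qed

text \<open>
  Two sets that together have more than \<open>p\<^sup>3\<close> residue vectors intersect. This is applied to the
  subset sums of one half and the reflection of those of the other half, shifted by one further
  vector, which guarantees that the zero sum is not empty.
\<close>

lemma exists_short_zero_sum: "\<exists>X\<subseteq>I. X \<noteq> {} \<and> card X \<le> p \<and> cong_zero p (sum a X)"
proof -
  obtain D1 where D1: "D1 \<subseteq> I" "card D1 \<le> (p - 1) div 2" "p ^ 3 < 2 * size_mod p (subset_sums p a D1)"
    using subset_sums_exceed_half[of "{}"] by auto
  obtain D2 where D2: "D2 \<subseteq> I - D1" "card D2 \<le> (p - 1) div 2" "p ^ 3 < 2 * size_mod p (subset_sums p a D2)"
    using subset_sums_exceed_half[OF D1(1,2)] by blast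
  have half: "2 * ((p - 1) div 2) < p" using large by linarith
  have D12: "D1 \<union> D2 \<subseteq> I" "card (D1 \<union> D2) < p"
    using D1 D2 card_Un_le[of D1 D2] half by auto
  have "I - (D1 \<union> D2) \<noteq> {}" using card_remaining[OF D12] by (metis card.empty not_one_le_zero add_leE)
  then obtain i where i: "i \<in> I" "i \<notin> D1" "i \<notin> D2" by blast
  let ?S1 = "subset_sums p a D1" and ?S2 = "subset_sums p a D2"
  \<comment> \<open>the residue vectors that a subset sum over \<open>D2\<close> and \<open>a i\<close> complete to zero\<close>
  define W where "W = {v \<in> residue_box p. - a i - v \<in> ?S2}"
  have "card (?S2 \<inter> residue_box p) \<le> card W"
  proof (rule card_inj_on_le)
    show "inj_on (\<lambda>w. reduce p (- a i - w)) (?S2 \<inter> residue_box p)"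
    proof (rule inj_onI)
      fix v w assume vw: "v \<in> ?S2 \<inter> residue_box p" "w \<in> ?S2 \<inter> residue_box p" "reduce p (- a i - v) = reduce p (- a i - w)"
      have "cong_zero p ((reduce p (- a i - v) - (- a i - v)) + ((- a i - w) - reduce p (- a i - w)))"
        using cong_zero_reduce cong_zero_minus by (intro cong_zero_add) blast+
      then have "cong_zero p (v - w)" unfolding vw(3) by (simp add: algebra_simps)
      then show "v = w" using vw residue_box_eqI by blast
    qed
    show "(\<lambda>w. reduce p (- a i - w)) ` (?S2 \<inter> residue_box p) \<subseteq> W"
    proof (rule image_subsetI)
      fix w assume w: "w \<in> ?S2 \<inter> residue_box p"
      have "cong_zero p ((- a i - reduce p (- a i - w)) - w)"
        using cong_zero_reduce[of p "- a i - w"] by (simp add: algebra_simps)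
      then have "- a i - reduce p (- a i - w) \<in> ?S2"
        using w periodicD[OF periodic_subset_sums] by blast
      then show "reduce p (- a i - w) \<in> W" using reduce_in_residue_box[OF p_pos] by (simp add: W_def)
    qed
  qed (simp add: W_def)
  then have "card (residue_box p) < card (?S1 \<inter> residue_box p) + card W"
    using D1(3) D2(3) unfolding size_mod_def card_residue_box by linarith
  moreover have "card (?S1 \<inter> residue_box p) + card W \<le> card (residue_box p)" if "(?S1 \<inter> residue_box p) \<inter> W = {}"
    using that by (subst card_Un_disjoint[symmetric]) (auto simp: W_def intro!: card_mono)
  ultimately obtain v where v: "v \<in> ?S1" "- a i - v \<in> ?S2" unfolding W_def by fastforce
  obtain X1 where X1: "X1 \<subseteq> D1" "cong_zero p (v - sum a X1)" using v unfolding subset_sums_def by blast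
  obtain X2 where X2: "X2 \<subseteq> D2" "cong_zero p (- a i - v - sum a X2)" using v unfolding subset_sums_def by blast
  have fin12: "finite X1" "finite X2" using X1 X2 D1 D2 fin by (meson Diff_subset finite_subset)+
  have dis: "X1 \<inter> X2 = {}" "i \<notin> X1 \<union> X2" using X1 X2 D2 i by blast+
  have "sum a (insert i (X1 \<union> X2)) = a i + (sum a X1 + sum a X2)"
    using fin12 dis by (simp add: sum.union_disjoint)
  moreover have "cong_zero p (0 - (a i + (sum a X1 + sum a X2)))"
    using cong_zero_add[OF X1(2) X2(2)] by (simp add: algebra_simps)
  ultimately have "cong_zero p (sum a (insert i (X1 \<union> X2)))"
    using cong_zero_minus[of p 0] by (metis diff_zero)
  moreover have "card (insert i (X1 \<union> X2)) \<le> p"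
  proof -
    have "card X1 \<le> card D1" "card X2 \<le> card D2"
      using X1 X2 D1 D2 fin by (meson Diff_subset card_mono finite_subset)+
    then show ?thesis
      using fin12 dis D1(2) D2(2) half card_Un_le[of X1 X2] by simp
  qed
  moreover have "insert i (X1 \<union> X2) \<subseteq> I" using X1 X2 D1 D2 i by blast
  ultimately show ?thesis by blast
qed

end

section \<open>Zero sums of length at most p modulo a prime p\<close>

definition int3_of :: "nat3 \<Rightarrow> int3" where
  "int3_of v = (int (fst v), int (fst (snd v)), int (snd (snd v)))"

lemma cong_zero_sum_int3_of: "cong_zero p (\<Sum>i\<in>X. int3_of (a i)) \<longleftrightarrow> zero_mod p (sum a X)"
proof -
  have "(\<Sum>i\<in>X. int3_of (a i)) = int3_of (sum a X)"
    by (simp add: int3_of_def prod_eq_iff fst_sum snd_sum)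
  then show ?thesis by (simp add: int3_of_def zero_mod_def)
qed

text \<open>
  Some coordinate of \<open>k\<close> is invertible modulo \<open>p\<close>; a zero sum of length \<open>p\<close> for the other
  two coordinates is then a zero sum for this one too, because the constant \<open>t\<close> is added \<open>p\<close> times.
\<close>

lemma zero_sum_in_affine_plane:
  fixes a :: "nat \<Rightarrow> nat3"
  assumes p: "prime p" "p \<noteq> 2" and L: "finite L" "card L \<ge> 4 * p - 2"
    and k: "\<not> cong_zero p k" and plane: "\<And>i. i \<in> L \<Longrightarrow> int p dvd dot k (int3_of (a i)) - t"
  shows "\<exists>X\<subseteq>L. card X = p \<and> zero_mod p (sum a X)"
proof -
  obtain k1 k2 k3 where k3: "k = (k1, k2, k3)" by (cases k)
  define x where "x = (\<lambda>i. fst (a i))"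
  define y where "y = (\<lambda>i. fst (snd (a i)))"
  define z where "z = (\<lambda>i. snd (snd (a i)))"
  have pp: "Factorial_Ring.prime (int p)" using p by simp
  have relation: "int p dvd k1 * int (sum x X) + k2 * int (sum y X) + k3 * int (sum z X)"
    if X: "X \<subseteq> L" "card X = p" for X
  proof -
    have "int p dvd (\<Sum>i\<in>X. dot k (int3_of (a i)) - t)" using X plane by (intro dvd_sum) auto
    then have "int p dvd (\<Sum>i\<in>X. dot k (int3_of (a i)))"
      using X(2) by (simp add: sum_subtractf dvd_diff_left_iff)
    also have "(\<Sum>i\<in>X. dot k (int3_of (a i))) = k1 * int (sum x X) + k2 * int (sum y X) + k3 * int (sum z X)"
      by (simp add: k3 int3_of_def x_def y_def z_def sum.distrib sum_distrib_left)
    finally show ?thesis .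
  qed
  have zm: "zero_mod p (sum a X) \<longleftrightarrow> p dvd sum x X \<and> p dvd sum y X \<and> p dvd sum z X" for X
    by (simp add: zero_mod_def x_def y_def z_def fst_sum snd_sum)
  have last: "p dvd s3" if "int p dvd c1 * int s1 + c2 * int s2 + c3 * int s3" "p dvd s1" "p dvd s2" "\<not> int p dvd c3"
    for c1 c2 c3 s1 s2 s3
  proof -
    have "int p dvd c1 * int s1 + c2 * int s2" using that by simp
    then have "int p dvd c3 * int s3" using that(1) by (simp add: dvd_add_right_iff)
    then show ?thesis using that(4) prime_dvd_mult_iff[OF pp] by auto
  qed
  consider "\<not> int p dvd k1" | "\<not> int p dvd k2" | "\<not> int p dvd k3" using k unfolding k3 by auto
  then show ?thesis
  proof cases
    case 1
    obtain X where X: "X \<subseteq> L" "card X = p" "p dvd sum y X" "p dvd sum z X"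
      using zero_sum_of_length_p_in_plane[OF p L] by blast
    then have "p dvd sum x X"
      using last[of k2 "sum y X" k3 "sum z X" k1 "sum x X"] relation[of X] 1 by (simp add: ac_simps)
    then show ?thesis using X zm by blast
  next
    case 2
    obtain X where X: "X \<subseteq> L" "card X = p" "p dvd sum x X" "p dvd sum z X"
      using zero_sum_of_length_p_in_plane[OF p L] by blast
    then have "p dvd sum y X"
      using last[of k1 "sum x X" k3 "sum z X" k2 "sum y X"] relation[of X] 2 by (simp add: ac_simps)
    then show ?thesis using X zm by blast
  next
    case 3
    obtain X where X: "X \<subseteq> L" "card X = p" "p dvd sum x X" "p dvd sum y X"
      using zero_sum_of_length_p_in_plane[OF p L] by blast
    then have "p dvd sum z X"
      using last[of k1 "sum x X" k2 "sum y X" k3 "sum z X"] relation[of X] 3 by simp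
    then show ?thesis using X zm by blast
  qed
qed

lemma short_zero_sums_2: "short_zero_sums 2 2 9"
  unfolding short_zero_sums_def
proof (intro allI impI)
  fix a :: "nat \<Rightarrow> nat3" and I :: "nat set"
  assume I: "finite I" "9 \<le> card I"
  define c where "c = (\<lambda>i. (fst (a i) mod 2, fst (snd (a i)) mod 2, snd (snd (a i)) mod 2))"
  have "c ` I \<subseteq> {..<2} \<times> {..<2} \<times> {..<2}" by (auto simp: c_def)
  then have "card (c ` I) \<le> card ({..<2::nat} \<times> {..<2::nat} \<times> {..<2::nat})" by (intro card_mono) auto
  then have "card (c ` I) < card I" using I(2) by (simp add: card_cartesian_product)
  then have "\<not> inj_on c I" by (rule pigeonhole)
  then obtain i j where ij: "i \<in> I" "j \<in> I" "i \<noteq> j" "c i = c j" by (auto simp: inj_on_def)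
  have "zero_mod 2 (sum a {i, j})"
  proof -
    have even: "2 dvd u + v" if "u mod 2 = v mod 2" for u v :: nat
      using that by presburger
    have "sum a {i, j} = a i + a j" using ij(3) by simp
    then show ?thesis using ij(4) even unfolding zero_mod_def c_def by (simp only: fst_add snd_add prod.inject)
  qed
  then show "\<exists>X\<subseteq>I. X \<noteq> {} \<and> card X \<le> 2 \<and> zero_mod 2 (sum a X)"
    using ij by (intro exI[of _ "{i, j}"]) auto
qed

text \<open>
  A plane with \<open>4p - 2\<close> members ends the proof at once. For \<open>p < 5000\<close> the \<open>p\<close> planes
  with constant first coordinate cannot all have fewer members, because
  \<open>p(4p - 3) < 20369(p - 1) + 1\<close>; for other \<open>p\<close> the greedy construction applies. The prime 2 is
  separate since the polynomial argument in planes needs \<open>p\<close> odd.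
\<close>

lemma short_zero_sums_prime:
  assumes p: "prime p"
  shows "short_zero_sums p p (20369 * (p - 1) + 1)"
proof (cases "p = 2")
  case True
  then show ?thesis using short_zero_sums_mono[OF short_zero_sums_2] by simp
next
  case False
  have p3: "p \<ge> 3" using False p prime_ge_2_nat[of p] by linarith
  show ?thesis
    unfolding short_zero_sums_def
  proof (intro allI impI, rule ccontr)
    fix a :: "nat \<Rightarrow> nat3" and I :: "nat set"
    assume I: "finite I" "20369 * (p - 1) + 1 \<le> card I"
      and non: "\<not> (\<exists>X\<subseteq>I. X \<noteq> {} \<and> card X \<le> p \<and> zero_mod p (sum a X))"
    let ?b = "\<lambda>i. int3_of (a i)"
    have plane: "card {i \<in> I. int p dvd dot k (?b i) - t} \<le> 4 * p - 3" if k: "\<not> cong_zero p k" for k t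
    proof (rule ccontr)
      let ?L = "{i \<in> I. int p dvd dot k (?b i) - t}"
      assume "\<not> card ?L \<le> 4 * p - 3"
      then have big: "card ?L \<ge> 4 * p - 2" by linarith
      have finL: "finite ?L" using I(1) by simp
      have "\<exists>X\<subseteq>?L. card X = p \<and> zero_mod p (sum a X)"
        by (rule zero_sum_in_affine_plane[OF p False finL big k, of a t]) blast
      then obtain X where X: "X \<subseteq> ?L" "card X = p" "zero_mod p (sum a X)" by blast
      have "X \<subseteq> I" using X(1) by blast
      moreover have "X \<noteq> {}" using X(2) p3 by (metis card.empty not_numeral_le_zero)
      moreover have "card X \<le> p" using X(2) by simp
      ultimately show False using non X(3) by blast
    qed
    show False
    proof (cases "p \<ge> 5000")
      case True
      then interpret thinly_spread p ?b I
        using p I plane by unfold_locales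
      show False using exists_short_zero_sum non by (simp add: cong_zero_sum_int3_of) 
    next
      case small: False
      have nn: "\<not> cong_zero p (1, 0, 0)" using p3 by auto
      have "I \<subseteq> (\<Union>t<p. {i \<in> I. int p dvd dot (1, 0, 0) (?b i) - int t})"
      proof
        fix i assume i: "i \<in> I"
        have "int p dvd int (fst (a i)) - int (fst (a i) mod p)"
          by (simp add: zmod_int minus_mod_eq_mult_div)
        then show "i \<in> (\<Union>t<p. {i \<in> I. int p dvd dot (1, 0, 0) (?b i) - int t})"
          using i p3 by (auto simp: int3_of_def intro!: bexI[of _ "fst (a i) mod p"])
      qed
      then have "card I \<le> card (\<Union>t<p. {i \<in> I. int p dvd dot (1, 0, 0) (?b i) - int t})"
        using I(1) by (intro card_mono) auto
      also have "\<dots> \<le> (\<Sum>t<p. card {i \<in> I. int p dvd dot (1, 0, 0) (?b i) - int t})" by (rule card_UN_le) simp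
      also have "\<dots> \<le> (\<Sum>t<p. 4 * p - 3)" by (intro sum_mono plane nn)
      also have "\<dots> = p * (4 * p - 3)" by simp
      also have "\<dots> < 20369 * (p - 1) + 1"
      proof (cases "p < 100")
        case True
        then have "p * (4 * p - 3) \<le> p * 400" by (intro mult_left_mono) auto
        then show ?thesis using p3 by linarith
      next
        case False
        have "p * (4 * p - 3) \<le> p * 19993" using small by (intro mult_left_mono) auto
        then show ?thesis using False by linarith
      qed
      finally show False using I(2) by simp
    qed
  qed
qed

text \<open>
  Zero sums of length at most \<open>p\<close> modulo \<open>p\<close> lose nothing: \<open>p * C(m - 1) + C(p - 1) = C(pm - 1)\<close>.
\<close>

lemma short_zero_sums_of_primes:
  assumes primes: "\<And>p. prime p \<Longrightarrow> short_zero_sums p p (C * (p - 1) + 1)"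
  shows "n > 0 \<Longrightarrow> short_zero_sums n n (C * (n - 1) + 1)"
proof (induction n rule: less_induct)
  case (less n)
  show ?case
  proof (cases "n = 1")
    case True
    then show ?thesis using short_zero_sums_one by simp
  next
    case False
    then obtain p m where p: "prime p" "n = p * m" using prime_factor_nat by blast
    then have m: "m > 0" "m < n" using less.prems prime_gt_1_nat by auto
    have "short_zero_sums (p * m) (p * m) (p * (C * (m - 1) + 1 - 1) + (C * (p - 1) + 1))"
      by (rule short_zero_sums_mult[OF primes[OF p(1)] less.IH[OF m(2,1)]]) simp
    moreover have "p * (C * (m - 1) + 1 - 1) + (C * (p - 1) + 1) = C * (p * m - 1) + 1"
    proof -
      obtain m' p' where "m = Suc m'" "p = Suc p'" using m prime_gt_0_nat[OF p(1)] by (metis gr0_implies_Suc)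
      then show ?thesis by (simp add: algebra_simps)
    qed
    ultimately show ?thesis using p by simp
  qed
qed

section \<open>From zero sums to powers\<close>

lemma forces_nth_power_of_short_zero_sums:
  assumes P: "short_zero_sums n l t" and n: "n > 0" and F: "\<forall>p\<in>F. prime p" "card F = 3"
  shows "forces_nth_power n F t"
  unfolding forces_nth_power_def
proof (intro allI impI, elim conjE)
  fix S assume S: "length S = t" "\<forall>a\<in>set S. smooth_over F a"
  obtain p1 p2 p3 where F3: "F = {p1, p2, p3}" using F(2) by (auto simp: card_3_iff)
  define a where "a = (\<lambda>i. (multiplicity p1 (S ! i), multiplicity p2 (S ! i), multiplicity p3 (S ! i)))"
  obtain X where X: "X \<subseteq> {..<t}" "X \<noteq> {}" "zero_mod n (sum a X)"
    using P unfolding short_zero_sums_def by (metis card_lessThan finite_lessThan order_refl)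
  have finX: "finite X" using X by (auto intro: finite_subset)
  have Spos: "S ! i > 0" and Sfac: "prime_factors (S ! i) \<subseteq> F" if "i \<in> X" for i
  proof -
    have "S ! i \<in> set S" using S X that by auto
    then show "S ! i > 0" "prime_factors (S ! i) \<subseteq> F" using S by (auto simp: smooth_over_def)
  qed
  have prod: "prod_list (nths S Z) = (\<Prod>i\<in>Z \<inter> {..<length S}. S ! i)" for Z
  proof (induction S rule: rev_induct)
    case (snoc x xs)
    have "Z \<inter> {..<length (xs @ [x])} = (if length xs \<in> Z then insert (length xs) (Z \<inter> {..<length xs})
           else Z \<inter> {..<length xs})"
      by (auto simp: less_Suc_eq)
    moreover have "(\<Prod>i\<in>Z \<inter> {..<length xs}. (xs @ [x]) ! i) = (\<Prod>i\<in>Z \<inter> {..<length xs}. xs ! i)"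
      by (intro prod.cong) (auto simp: nth_append)
    ultimately show ?case using snoc by (simp add: nths_append mult.commute)
  qed simp
  then have prod': "prod_list (nths S X) = (\<Prod>i\<in>X. S ! i)"
    using X S by (simp add: Int_absorb2)
  have "n dvd multiplicity p (\<Prod>i\<in>X. S ! i)" if p: "prime p" for p
  proof -
    have eq: "multiplicity p (\<Prod>i\<in>X. S ! i) = (\<Sum>i\<in>X. multiplicity p (S ! i))"
    proof (rule prime_elem_multiplicity_prod_distrib)
      show "0 \<notin> (!) S ` X" using Spos by (metis imageE less_numeral_extra(3))
    qed (use finX p in auto)
    show ?thesis
    proof (cases "p \<in> F")
      case True
      then show ?thesis unfolding eq F3 using X(3)
        by (auto simp: zero_mod_def a_def fst_sum snd_sum)
    next
      case False
      have "multiplicity p (S ! i) = 0" if "i \<in> X" for i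
        using Sfac[OF that] Spos[OF that] False p
        by (intro not_dvd_imp_multiplicity_0) (auto simp: prime_factors_dvd)
      then show ?thesis unfolding eq by simp
    qed
  qed
  then have "is_nth_power n (prod_list (nths S X))"
    unfolding prod' using n by (simp add: is_nth_power_conv_multiplicity_nat)
  then have "is_nth_power n (int (prod_list (nths S X)))"
    by (metis is_nth_power_def of_nat_power)
  moreover have "nths S X \<noteq> []"
  proof -
    obtain i where "i \<in> X" using X by blast
    then have "S ! i \<in> set (nths S X)" using X S by (auto simp: set_nths)
    then show ?thesis by auto
  qed
  ultimately show "\<exists>S'. subseq S' S \<and> S' \<noteq> [] \<and> is_nth_power n (int (prod_list S'))"
    using subseq_conv_nths by blast
qed

theorem theorem3p13:
  fixes n :: nat and F :: "nat set"
  assumes "n \<ge> 2"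
    and "\<forall>p\<in>F. prime p" and "card F = 3"
  shows "power_const n F \<le> min 20369 (3 ^ card (prime_factors n)) * (n - 1) + 1"
proof -
  have n: "n > 0" using assms(1) by simp
  have bound: "power_const n F \<le> t" if "short_zero_sums n l t" "t > 0" for l t
    unfolding power_const_def
    using forces_nth_power_of_short_zero_sums[OF that(1) n assms(2,3)] that(2) by (intro Least_le) simp
  obtain l where "short_zero_sums n l (3 ^ card (prime_factors n) * (n - 1) + 1)"
    using short_zero_sums_omega[OF n] by blast
  then have "power_const n F \<le> 3 ^ card (prime_factors n) * (n - 1) + 1" by (rule bound) simp
  moreover have "power_const n F \<le> 20369 * (n - 1) + 1"
    by (rule bound[OF short_zero_sums_of_primes[OF short_zero_sums_prime n]]) simp_all
  ultimately show ?thesis by (simp add: min_def)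
qed

end
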